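(* 1. For every graph $F$, $W_{\mathrm{tw}}(F)\ge v(F_0)$, where $F_0$ is the core of $F$. 2. For every connected graph $F$, $W_{\mathrm{tw}}(F)\ge \mathrm{tw}(F)+1$, except in the case that $F$ is a subtree of some megastar $M_{3,b}$.
   Context: Graphs are finite simple graphs; $v(F)$ is the number of vertices and $\mathrm{tw}(F)$ the treewidth. We use first-order logic of graphs with relation symbols for adjacency and equality only; the variable width of a sentence is the number of distinct variables it uses. $W_{\mathrm{tw}}(F)$ is the minimum variable width of a first-order sentence $\Phi$ for which there is an integer $k$ such that for every connected graph $G$ with $\mathrm{tw}(G)\ge k$, $G\models\Phi$ if and only if $G$ contains a (not necessarily induced) subgraph isomorphic to $F$. The core $F_0$ of $F$ is the graph obtained from $F$ by removing, consecutively and as long as possible, vertices of degree at most 1 (it is empty if $F$ is a forest). The megastar $M_{s,t}$ is obtained from the star $K_{1,s}$ by subdividing each edge into a path with $t+1$ vertices (so $v(M_{s,t})=st+1$). *)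

theory Defs
  imports Main
begin

record 'a sgraph =
  verts :: "'a set"
  edges :: "'a set set"

definition sgraph :: "('a, 'b) sgraph_scheme \<Rightarrow> bool" where
  "sgraph G \<longleftrightarrow> finite (verts G) \<and>
     (\<forall>e\<in>edges G. \<exists>u v. u \<in> verts G \<and> v \<in> verts G \<and> u \<noteq> v \<and> e = {u, v})"

definition adj :: "'a sgraph \<Rightarrow> 'a \<Rightarrow> 'a \<Rightarrow> bool" where
  "adj G u v \<longleftrightarrow> {u, v} \<in> edges G"

definition connected_set :: "'a sgraph \<Rightarrow> 'a set \<Rightarrow> bool" where
  "connected_set G S \<longleftrightarrow>
     (\<forall>x\<in>S. \<forall>y\<in>S. (\<lambda>u v. u \<in> S \<and> v \<in> S \<and> adj G u v)\<^sup>*\<^sup>* x y)"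

definition connected :: "'a sgraph \<Rightarrow> bool" where
  "connected G \<longleftrightarrow> verts G \<noteq> {} \<and> connected_set G (verts G)"

definition contains :: "'b sgraph \<Rightarrow> 'a sgraph \<Rightarrow> bool" where
  "contains G F \<longleftrightarrow> (\<exists>f. inj_on f (verts F) \<and> f ` verts F \<subseteq> verts G \<and>
      (\<forall>u\<in>verts F. \<forall>v\<in>verts F. adj F u v \<longrightarrow> adj G (f u) (f v)))"

definition is_tree :: "'a sgraph \<Rightarrow> bool" where
  "is_tree T \<longleftrightarrow> sgraph T \<and> connected T \<and> card (edges T) + 1 = card (verts T)"

definition tree_decomposition :: "'a sgraph \<Rightarrow> nat sgraph \<Rightarrow> (nat \<Rightarrow> 'a set) \<Rightarrow> bool" where
  "tree_decomposition G T B \<longleftrightarrow> is_tree T \<and>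
     (\<forall>t\<in>verts T. B t \<subseteq> verts G) \<and>
     (\<forall>v\<in>verts G. \<exists>t\<in>verts T. v \<in> B t) \<and>
     (\<forall>e\<in>edges G. \<exists>t\<in>verts T. e \<subseteq> B t) \<and>
     (\<forall>v\<in>verts G. connected_set T {t \<in> verts T. v \<in> B t})"

definition treewidth :: "'a sgraph \<Rightarrow> nat" where
  "treewidth G = (LEAST k. \<exists>T B. tree_decomposition G T B \<and>
                              (\<forall>t\<in>verts T. card (B t) \<le> k + 1))"

datatype fo = FTrue | Adj nat nat | Eq nat nat | Neg fo | Conj fo fo | Ex nat fo

fun vars :: "fo \<Rightarrow> nat set" where
  "vars FTrue = {}"
| "vars (Adj x y) = {x, y}"
| "vars (Eq x y) = {x, y}"
| "vars (Neg \<phi>) = vars \<phi>"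
| "vars (Conj \<phi> \<psi>) = vars \<phi> \<union> vars \<psi>"
| "vars (Ex x \<phi>) = insert x (vars \<phi>)"

fun free_vars :: "fo \<Rightarrow> nat set" where
  "free_vars FTrue = {}"
| "free_vars (Adj x y) = {x, y}"
| "free_vars (Eq x y) = {x, y}"
| "free_vars (Neg \<phi>) = free_vars \<phi>"
| "free_vars (Conj \<phi> \<psi>) = free_vars \<phi> \<union> free_vars \<psi>"
| "free_vars (Ex x \<phi>) = free_vars \<phi> - {x}"

fun sat :: "'a sgraph \<Rightarrow> (nat \<Rightarrow> 'a) \<Rightarrow> fo \<Rightarrow> bool" where
  "sat G a FTrue = True"
| "sat G a (Adj x y) = adj G (a x) (a y)"
| "sat G a (Eq x y) = (a x = a y)"
| "sat G a (Neg \<phi>) = (\<not> sat G a \<phi>)"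
| "sat G a (Conj \<phi> \<psi>) = (sat G a \<phi> \<and> sat G a \<psi>)"
| "sat G a (Ex x \<phi>) = (\<exists>v\<in>verts G. sat G (a(x := v)) \<phi>)"

definition sentence :: "fo \<Rightarrow> bool" where
  "sentence \<phi> \<longleftrightarrow> free_vars \<phi> = {}"

definition var_width :: "fo \<Rightarrow> nat" where
  "var_width \<phi> = card (vars \<phi>)"

text \<open>Truth of a sentence (the assignment is irrelevant for sentences).\<close>
definition models :: "'a sgraph \<Rightarrow> fo \<Rightarrow> bool" where
  "models G \<phi> \<longleftrightarrow> sat G (\<lambda>_. undefined) \<phi>"

text \<open>W_tw(F). Host graphs G range over finite simple graphs on vertex type nat
  (every finite graph is isomorphic to one of these).\<close>
definition W_tw :: "'a sgraph \<Rightarrow> nat" where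
  "W_tw F = (LEAST n. \<exists>\<Phi>. sentence \<Phi> \<and> var_width \<Phi> = n \<and>
      (\<exists>k. \<forall>G :: nat sgraph. sgraph G \<and> connected G \<and> treewidth G \<ge> k \<longrightarrow>
              (models G \<Phi> \<longleftrightarrow> contains G F)))"

definition degree :: "'a sgraph \<Rightarrow> 'a \<Rightarrow> nat" where
  "degree G v = card {u \<in> verts G. adj G v u}"

definition delete_vertex :: "'a sgraph \<Rightarrow> 'a \<Rightarrow> 'a sgraph" where
  "delete_vertex G v = \<lparr>verts = verts G - {v}, edges = {e \<in> edges G. v \<notin> e}\<rparr>"

definition peel :: "'a sgraph \<Rightarrow> 'a sgraph \<Rightarrow> bool" where
  "peel G H \<longleftrightarrow> (\<exists>v\<in>verts G. degree G v \<le> 1 \<and> H = delete_vertex G v)"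

definition is_core :: "'a sgraph \<Rightarrow> 'a sgraph \<Rightarrow> bool" where
  "is_core F F0 \<longleftrightarrow> peel\<^sup>*\<^sup>* F F0 \<and> (\<forall>v\<in>verts F0. degree F0 v \<ge> 2)"

text \<open>M_{s,t}: centre 0, arm i (i<s) consists of vertices i*t+1, ..., i*t+t in path order.\<close>
definition megastar :: "nat \<Rightarrow> nat \<Rightarrow> nat sgraph" where
  "megastar s t = \<lparr>verts = {0} \<union> {i * t + j | i j. i < s \<and> 1 \<le> j \<and> j \<le> t},
     edges = {{0, i * t + 1} | i. i < s \<and> 1 \<le> t} \<union>
             {{i * t + j, i * t + j + 1} | i j. i < s \<and> 1 \<le> j \<and> j < t}\<rparr>"

end

theory Submission
  imports Defs
begin

text \<open>Let \<open>l\<close> be the number of vertices of the core \<open>F\<^sub>0\<close>. Glue to every vertex of the complete graph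
  \<open>K\<^sub>l\<close> a copy of one rooted graph that consists of a large tree and of a graph of large treewidth
  all of whose cycles are longer than \<open>v(F)\<close>. The result contains \<open>F\<close>. The same construction over
  \<open>K\<^bsub>l-1\<^esub>\<close> does not: a small subgraph of minimum degree two cannot leave the clique. In the pebble
  game with \<open>l - 1\<close> pebbles Duplicator only has to respect equality of clique vertices, so the two
  graphs are indistinguishable with fewer than \<open>l\<close> variables.

  For the second part, attaching leaf bags for the peeled vertices gives
  \<open>tw(F) + 1 \<le> max(2, l)\<close>. It remains to show \<open>W \<ge> 2\<close> if \<open>F\<close> is not contained in a megastar
  \<open>M\<^bsub>3,b\<^esub>\<close>. One variable cannot tell nonempty graphs apart, a large complete graph contains \<open>F\<close>, and a
  graph of maximum degree three with large treewidth and long subdivided edges does not, since its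
  small connected subgraphs embed into megastars.\<close>

section \<open>Graphs and connectivity\<close>

text \<open>A sentence has to be right only on hosts of treewidth at least some unknown
  \<open>k\<close>, so bare cliques on \<open>l\<close> and \<open>l - 1\<close> vertices refute
  nothing: both hosts must carry large treewidth without offering a second place for the core. Large
  treewidth and local sparseness are compatible because a clique minor survives the subdivision of
  edges. Every clique vertex gets the same rooted graph because Duplicator answers by repeating the
  position inside a copy and choosing only the copy. Arm length, depth and branching of the tree are
  set to \<open>v(F)\<close>: an image of \<open>F\<close> then cannot hold an arm and one vertex
  more, and the tree has room for every peeled vertex. Long cycles enter as a density condition: a
  small set in which every vertex but the root has two neighbours within the set is contained in the
  root. This form passes to the slice of an image of \<open>F0\<close> in one copy, where only the
  root can have neighbours elsewhere. The 2 in the maximum is for forests, where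
  \<open>l = 0\<close> and the first bound says nothing.\<close>

definition rel_graph :: "'a set \<Rightarrow> ('a \<Rightarrow> 'a \<Rightarrow> bool) \<Rightarrow> 'a sgraph" where
  "rel_graph V P = \<lparr>verts = V, edges = {{u, v} | u v. u \<in> V \<and> v \<in> V \<and> u \<noteq> v \<and> P u v}\<rparr>"

lemma verts_rel_graph [simp]: "verts (rel_graph V P) = V"
  by (simp add: rel_graph_def)

text \<open>Edges are unordered pairs of distinct vertices, so \<open>P\<close> may list each edge
  in one direction only and loops vanish by construction.\<close>

lemma adj_rel_graph:
  "adj (rel_graph V P) u v \<longleftrightarrow> u \<in> V \<and> v \<in> V \<and> u \<noteq> v \<and> (P u v \<or> P v u)"
  by (auto simp: rel_graph_def adj_def doubleton_eq_iff)

lemma sgraph_rel_graph: "finite V \<Longrightarrow> sgraph (rel_graph V P)"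
  by (auto simp: rel_graph_def sgraph_def)

lemma adj_sym: "adj G u v \<Longrightarrow> adj G v u"
  by (simp add: adj_def insert_commute)

lemma adjD:
  assumes "sgraph G" "adj G u v"
  shows "u \<in> verts G" "v \<in> verts G" "u \<noteq> v"
proof -
  obtain a b where "a \<in> verts G" "b \<in> verts G" "a \<noteq> b" "{u, v} = {a, b}"
    using assms unfolding sgraph_def adj_def by blast
  then show "u \<in> verts G" "v \<in> verts G" "u \<noteq> v"
    by (auto simp: doubleton_eq_iff)
qed

lemma edge_ends:
  assumes "sgraph G" "e \<in> edges G"
  shows "\<exists>u v. e = {u, v} \<and> adj G u v \<and> u \<in> verts G \<and> v \<in> verts G \<and> u \<noteq> v"
  using assms unfolding sgraph_def adj_def by metis

lemma finite_edges: "sgraph G \<Longrightarrow> finite (edges G)"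
  by (rule finite_subset[of _ "Pow (verts G)"]) (auto simp: sgraph_def)

abbreviation reach :: "'a sgraph \<Rightarrow> 'a set \<Rightarrow> 'a \<Rightarrow> 'a \<Rightarrow> bool" where
  "reach G S \<equiv> (\<lambda>u v. u \<in> S \<and> v \<in> S \<and> adj G u v)\<^sup>*\<^sup>*"

lemma reach_sym: "reach G S x y \<Longrightarrow> reach G S y x"
proof (induction rule: rtranclp_induct)
  case (step y z)
  then show ?case
    by (intro converse_rtranclp_into_rtranclp[of _ z y]) (auto intro: adj_sym)
qed simp

lemma reach_image:
  assumes "reach G S x y" "\<And>u v. u \<in> S \<Longrightarrow> v \<in> S \<Longrightarrow> adj G u v \<Longrightarrow> adj H (f u) (f v)"
    and "f ` S \<subseteq> S'"
  shows "reach H S' (f x) (f y)"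
  using assms(1)
proof (induction rule: rtranclp_induct)
  case (step y z)
  then show ?case
    using assms by (intro rtranclp.rtrancl_into_rtrancl[of _ "f x" "f y" "f z"]) auto
qed simp

lemma reach_mono: "reach G S x y \<Longrightarrow> S \<subseteq> S' \<Longrightarrow> reach G S' x y"
  using reach_image[where f = "\<lambda>x. x" and G = G and S = S and H = G and S' = S'] by simp

lemma reach_first_step:
  assumes "reach G S x y" "x \<noteq> y"
  shows "\<exists>u\<in>S. adj G x u"
  using assms(1) by (rule converse_rtranclpE) (use assms(2) in auto)

lemma connected_setI:
  assumes "\<And>x. x \<in> S \<Longrightarrow> reach G S x r"
  shows "connected_set G S"
  unfolding connected_set_def
proof (intro ballI)
  fix x y assume "x \<in> S" "y \<in> S"
  then have "reach G S x r" "reach G S r y" using assms by (auto intro: reach_sym)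
  then show "reach G S x y" by (rule rtranclp_trans)
qed

lemma connected_setD: "connected_set G S \<Longrightarrow> x \<in> S \<Longrightarrow> y \<in> S \<Longrightarrow> reach G S x y"
  unfolding connected_set_def by blast

lemma connected_set_image:
  assumes "connected_set G S"
    and "\<And>u v. u \<in> S \<Longrightarrow> v \<in> S \<Longrightarrow> adj G u v \<Longrightarrow> adj H (f u) (f v)"
  shows "connected_set H (f ` S)"
  unfolding connected_set_def
proof safe
  fix x y assume "x \<in> S" "y \<in> S"
  then show "reach H (f ` S) (f x) (f y)"
    using connected_setD[OF assms(1)] by (intro reach_image[where H = H, OF _ assms(2)]) auto
qed

text \<open>Serves to locate a connected set: it suffices to name a region that it meets and that no
  edge of the set leaves.\<close>

lemma connected_set_subset_closed:
  assumes "connected_set G S" "x \<in> S" "x \<in> Y"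
    and "\<And>u v. u \<in> S \<Longrightarrow> u \<in> Y \<Longrightarrow> v \<in> S \<Longrightarrow> adj G u v \<Longrightarrow> v \<in> Y"
  shows "S \<subseteq> Y"
proof
  fix y assume "y \<in> S"
  with assms(1,2) have "reach G S x y" by (rule connected_setD)
  then show "y \<in> Y"
  proof (induction rule: rtranclp_induct)
    case (step y z)
    then show ?case using assms(4) by blast
  qed (rule assms(3))
qed

lemma containsI:
  assumes "inj_on f (verts F)" "\<And>u. u \<in> verts F \<Longrightarrow> f u \<in> verts G"
    and "\<And>u v. u \<in> verts F \<Longrightarrow> v \<in> verts F \<Longrightarrow> adj F u v \<Longrightarrow> adj G (f u) (f v)"
  shows "contains G F"
  unfolding contains_def using assms by (intro exI[of _ f] conjI ballI impI) auto

lemma containsE: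
  assumes "contains G F"
  obtains f where "inj_on f (verts F)" "\<And>u. u \<in> verts F \<Longrightarrow> f u \<in> verts G"
    and "\<And>u v. u \<in> verts F \<Longrightarrow> v \<in> verts F \<Longrightarrow> adj F u v \<Longrightarrow> adj G (f u) (f v)"
proof -
  from assms obtain f where "inj_on f (verts F)" "f ` verts F \<subseteq> verts G"
    "\<forall>u\<in>verts F. \<forall>v\<in>verts F. adj F u v \<longrightarrow> adj G (f u) (f v)"
    unfolding contains_def by (elim exE conjE)
  then show thesis by (intro that[of f]) auto
qed

lemma contains_trans:
  assumes "contains G H" "contains H F"
  shows "contains G F"
proof -
  obtain g where g: "inj_on g (verts H)" "\<And>u. u \<in> verts H \<Longrightarrow> g u \<in> verts G"
    "\<And>u v. u \<in> verts H \<Longrightarrow> v \<in> verts H \<Longrightarrow> adj H u v \<Longrightarrow> adj G (g u) (g v)"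
    by (rule containsE[OF assms(1)]) (rule that)
  obtain f where f: "inj_on f (verts F)" "\<And>u. u \<in> verts F \<Longrightarrow> f u \<in> verts H"
    "\<And>u v. u \<in> verts F \<Longrightarrow> v \<in> verts F \<Longrightarrow> adj F u v \<Longrightarrow> adj H (f u) (f v)"
    by (rule containsE[OF assms(2)]) (rule that)
  show ?thesis
  proof (rule containsI)
    show "inj_on (\<lambda>u. g (f u)) (verts F)"
      using f(1,2) g(1) by (simp add: inj_on_def)
    show "g (f u) \<in> verts G" if "u \<in> verts F" for u
      using that by (intro g f)
    show "adj G (g (f u)) (g (f v))" if "u \<in> verts F" "v \<in> verts F" "adj F u v" for u v
      using that by (intro g f)
  qed
qed

section \<open>Treewidth and clique minors\<close>

lemma handshake:
  assumes "sgraph G"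
  shows "(\<Sum>v\<in>verts G. degree G v) = 2 * card (edges G)"
proof -
  have "degree G v = card {e \<in> edges G. v \<in> e}" if "v \<in> verts G" for v
    unfolding degree_def
  proof (rule bij_betw_same_card)
    show "bij_betw (\<lambda>u. {v, u}) {u \<in> verts G. adj G v u} {e \<in> edges G. v \<in> e}"
    proof (rule bij_betw_imageI)
      show "inj_on (\<lambda>u. {v, u}) {u \<in> verts G. adj G v u}"
        by (auto simp: inj_on_def doubleton_eq_iff)
      show "(\<lambda>u. {v, u}) ` {u \<in> verts G. adj G v u} = {e \<in> edges G. v \<in> e}"
      proof safe
        fix e assume "e \<in> edges G" "v \<in> e"
        then obtain a b where "e = {a, b}" "adj G a b" "a \<in> verts G" "b \<in> verts G"
          using edge_ends[OF assms] by blast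
        with \<open>v \<in> e\<close> show "e \<in> (\<lambda>u. {v, u}) ` {u \<in> verts G. adj G v u}"
          by (auto simp: insert_commute intro: adj_sym)
      qed (auto simp: adj_def)
    qed
  qed
  then have "(\<Sum>v\<in>verts G. degree G v) = (\<Sum>v\<in>verts G. card {e \<in> edges G. v \<in> e})"
    by simp
  also have "\<dots> = 2 * card (edges G)"
  proof (rule sum_multicount)
    show "finite (verts G)" using assms by (simp add: sgraph_def)
    show "finite (edges G)" using assms by (rule finite_edges)
    show "\<forall>e\<in>edges G. card {v \<in> verts G. v \<in> e} = 2"
    proof
      fix e assume "e \<in> edges G"
      then obtain a b where "e = {a, b}" "a \<in> verts G" "b \<in> verts G" "a \<noteq> b"
        using edge_ends[OF assms] by blast
      moreover from this have "{v \<in> verts G. v \<in> e} = {a, b}" by auto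
      ultimately show "card {v \<in> verts G. v \<in> e} = 2" by simp
    qed
  qed
  finally show ?thesis .
qed

text \<open>If all degrees were at least two, the handshake sum would give at least as many edges as
  vertices, one more than a tree has. Connectedness supplies the one neighbour as soon as there is a
  second vertex.\<close>

lemma tree_leaf:
  assumes T: "is_tree T" and "card (verts T) \<noteq> 1"
  obtains t s where "t \<in> verts T" "adj T t s" "\<And>u. adj T t u \<Longrightarrow> u = s"
proof -
  have sg: "sgraph T" and co: "connected T" and ca: "card (edges T) + 1 = card (verts T)"
    using T by (auto simp: is_tree_def)
  have fin: "finite (verts T)" using sg by (simp add: sgraph_def)
  have "\<exists>t\<in>verts T. degree T t < 2"
  proof (rule ccontr)
    assume "\<not> ?thesis"
    then have "(\<Sum>v\<in>verts T. 2) \<le> (\<Sum>v\<in>verts T. degree T v)"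
      by (intro sum_mono) auto
    then show False using handshake[OF sg] ca by simp
  qed
  then obtain t where t: "t \<in> verts T" "degree T t < 2" by blast
  have "verts T \<noteq> {t}" using assms(2) by auto
  then obtain y where y: "y \<in> verts T" "y \<noteq> t" using t by blast
  have "reach T (verts T) t y"
    using co y t by (simp add: connected_def connected_setD)
  then obtain s where s: "adj T t s" "s \<in> verts T"
    using reach_first_step[of "verts T" T t y] y(2) by blast
  have "u = s" if "adj T t u" for u
  proof (rule ccontr)
    assume "u \<noteq> s"
    have "{u, s} \<subseteq> {u \<in> verts T. adj T t u}"
      using that s adjD[OF sg] by auto
    then have "card {u, s} \<le> degree T t"
      unfolding degree_def using fin by (intro card_mono) auto
    with \<open>u \<noteq> s\<close> t(2) show False by simp
  qed
  with t s that show thesis by blast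
qed

lemma verts_delete_vertex [simp]: "verts (delete_vertex G v) = verts G - {v}"
  by (simp add: delete_vertex_def)

lemma adj_delete_vertex: "adj (delete_vertex G t) u v \<longleftrightarrow> adj G u v \<and> u \<noteq> t \<and> v \<noteq> t"
  by (auto simp: delete_vertex_def adj_def)

lemma sgraph_delete_vertex:
  assumes "sgraph G"
  shows "sgraph (delete_vertex G v)"
  unfolding sgraph_def
proof (intro conjI ballI)
  show "finite (verts (delete_vertex G v))" using assms by (simp add: sgraph_def)
  fix e assume "e \<in> edges (delete_vertex G v)"
  then have "e \<in> edges G" "v \<notin> e" by (auto simp: delete_vertex_def)
  then show "\<exists>a b. a \<in> verts (delete_vertex G v) \<and> b \<in> verts (delete_vertex G v) \<and> a \<noteq> b \<and> e = {a, b}"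
    using edge_ends[OF assms] by fastforce
qed

text \<open>A walk that visits \<open>t\<close> enters and leaves it through \<open>s\<close>, so
  the visit can be cut out.\<close>

lemma connected_set_delete_leaf:
  assumes "sgraph G" "connected_set G X" and leaf: "\<And>u. adj G t u \<Longrightarrow> u = s"
  shows "connected_set (delete_vertex G t) (X - {t})"
  unfolding connected_set_def
proof (intro ballI)
  let ?R = "reach (delete_vertex G t) (X - {t})"
  fix x y assume xy: "x \<in> X - {t}" "y \<in> X - {t}"
  with assms(2) have "reach G X x y" by (auto dest: connected_setD)
  \<comment> \<open>While the walk sits at \<open>t\<close>, the shortened walk waits at
    \<open>s\<close>.\<close>
  then have "(y \<noteq> t \<longrightarrow> ?R x y) \<and> (y = t \<longrightarrow> ?R x s)"
  proof (induction rule: rtranclp_induct)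
    case base
    then show ?case using xy by simp
  next
    case (step y z)
    have yz: "y \<in> X" "z \<in> X" "adj G y z" "y \<noteq> z"
      using step.hyps(2) adjD[OF assms(1)] by auto
    consider "y = t" | "z = t" | "y \<noteq> t" "z \<noteq> t" by blast
    then show ?case
    proof cases
      case 1
      then have "z = s" using yz leaf by blast
      with 1 step.IH yz show ?thesis by auto
    next
      case 2
      then have "y = s" using yz leaf adj_sym by metis
      with 2 step.IH yz show ?thesis by auto
    next
      case 3
      then have "?R x y" "y \<in> X - {t} \<and> z \<in> X - {t} \<and> adj (delete_vertex G t) y z"
        using step.IH yz by (auto simp: adj_delete_vertex)
      with 3 show ?thesis by (simp add: rtranclp.rtrancl_into_rtrancl)
    qed
  qed
  then show "?R x y" using xy by simp
qed

lemma is_tree_delete_leaf: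
  assumes T: "is_tree T" and t: "t \<in> verts T" "adj T t s" and leaf: "\<And>u. adj T t u \<Longrightarrow> u = s"
  shows "is_tree (delete_vertex T t)"
proof -
  have sg: "sgraph T" and co: "connected T" and ca: "card (edges T) + 1 = card (verts T)"
    using T by (auto simp: is_tree_def)
  have fin: "finite (verts T)" using sg by (simp add: sgraph_def)
  have "edges (delete_vertex T t) = edges T - {{t, s}}"
  proof -
    have "e = {t, s}" if "e \<in> edges T" "t \<in> e" for e
    proof -
      obtain u v where "e = {u, v}" "adj T u v" using edge_ends[OF sg \<open>e \<in> edges T\<close>] by blast
      with that(2) leaf show ?thesis by (metis adj_sym insert_commute insertE singletonD)
    qed
    then show ?thesis by (auto simp: delete_vertex_def)
  qed
  moreover have "{t, s} \<in> edges T" using t by (simp add: adj_def)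
  ultimately have "card (edges (delete_vertex T t)) + 1 = card (edges T)"
    using finite_edges[OF sg] by (metis Suc_eq_plus1 card_Suc_Diff1)
  moreover have "card (verts (delete_vertex T t)) + 1 = card (verts T)"
    using t fin by (simp add: card_Suc_Diff1 del: card_Diff_insert)
  moreover have "verts (delete_vertex T t) \<noteq> {}"
    using adjD[OF sg t(2)] by auto
  moreover have "connected_set (delete_vertex T t) (verts (delete_vertex T t))"
    using connected_set_delete_leaf[OF sg _ leaf, of "verts T"] co by (auto simp: connected_def)
  ultimately show ?thesis
    using ca sgraph_delete_vertex[OF sg] by (simp add: is_tree_def connected_def)
qed

text \<open>Induction by deleting a leaf \<open>t\<close> with neighbour \<open>s\<close>. If some
  member is \<open>{t}\<close>, pairwise intersection puts \<open>t\<close> into all members.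
  Otherwise every member through \<open>t\<close> also contains \<open>s\<close>, so two members
  that meet in \<open>t\<close> still meet in \<open>s\<close> after the deletion. The case
  \<open>i = j\<close> of the last hypothesis says that the members are nonempty.\<close>

lemma subtree_Helly:
  assumes "is_tree T"
    and "\<And>i. i \<in> I \<Longrightarrow> X i \<subseteq> verts T" "\<And>i. i \<in> I \<Longrightarrow> connected_set T (X i)"
    and "\<And>i j. i \<in> I \<Longrightarrow> j \<in> I \<Longrightarrow> X i \<inter> X j \<noteq> {}"
  shows "\<exists>t\<in>verts T. \<forall>i\<in>I. t \<in> X i"
  using assms
proof (induction "card (verts T)" arbitrary: T X rule: less_induct)
  case less
  have sg: "sgraph T" and fin: "finite (verts T)"
    using less.prems(1) by (auto simp: is_tree_def sgraph_def)
  show ?case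
  proof (cases "card (verts T) = 1")
    case True
    then obtain t where t: "verts T = {t}" by (auto simp: card_1_singleton_iff)
    have "t \<in> X i" if "i \<in> I" for i
      using less.prems(2)[OF that] less.prems(4)[OF that that] t by auto
    with t show ?thesis by auto
  next
    case False
    obtain t s where t: "t \<in> verts T" "adj T t s" and leaf: "\<And>u. adj T t u \<Longrightarrow> u = s"
      by (rule tree_leaf[OF less.prems(1) False]) (rule that)
    show ?thesis
    proof (cases "\<exists>i\<in>I. X i = {t}")
      case True
      then obtain i where "i \<in> I" "X i = {t}" by blast
      then have "\<forall>j\<in>I. t \<in> X j" using less.prems(4)[of i] by auto
      with t show ?thesis by blast
    next
      case nt: False
      have s: "s \<in> X i" if i: "i \<in> I" and ti: "t \<in> X i" for i
      proof -
        obtain y where "y \<in> X i" "y \<noteq> t" using nt i ti by blast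
        then have "reach T (X i) t y" using connected_setD[OF less.prems(3)[OF i]] ti by blast
        then obtain u where "adj T t u" "u \<in> X i" using reach_first_step[of "X i" T t y] \<open>y \<noteq> t\<close> by blast
        with leaf show ?thesis by blast
      qed
      have "s \<noteq> t" using adjD(3)[OF sg t(2)] by simp
      have "\<exists>r\<in>verts (delete_vertex T t). \<forall>i\<in>I. r \<in> X i - {t}"
      proof (rule less.hyps)
        show "card (verts (delete_vertex T t)) < card (verts T)"
          using card_Diff1_less[OF fin t(1)] by simp
        show "is_tree (delete_vertex T t)"
          using is_tree_delete_leaf[OF less.prems(1) t leaf] .
        show "X i - {t} \<subseteq> verts (delete_vertex T t)" if "i \<in> I" for i
          using less.prems(2)[OF that] by auto
        show "connected_set (delete_vertex T t) (X i - {t})" if "i \<in> I" for i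
          using connected_set_delete_leaf[OF sg less.prems(3)[OF that] leaf] .
        show "(X i - {t}) \<inter> (X j - {t}) \<noteq> {}" if ij: "i \<in> I" "j \<in> I" for i j
        proof -
          obtain r where r: "r \<in> X i" "r \<in> X j" using less.prems(4)[OF ij] by blast
          show ?thesis
          proof (cases "r = t")
            case True
            then show ?thesis using s[OF ij(1)] s[OF ij(2)] r \<open>s \<noteq> t\<close> by auto
          next
            case False
            then show ?thesis using r by auto
          qed
        qed
      qed
      then show ?thesis by auto
    qed
  qed
qed

section \<open>Clique minors, given by their branch sets, and treewidth\<close>

definition clique_minor :: "'a sgraph \<Rightarrow> nat \<Rightarrow> bool" where
  "clique_minor G n \<longleftrightarrow> (\<exists>M. (\<forall>i<n. M i \<subseteq> verts G \<and> M i \<noteq> {} \<and> connected_set G (M i)) \<and>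
     (\<forall>i<n. \<forall>j<n. i \<noteq> j \<longrightarrow> M i \<inter> M j = {} \<and> (\<exists>u\<in>M i. \<exists>v\<in>M j. adj G u v)))"

lemma clique_minorE:
  assumes "clique_minor G n"
  obtains M where "\<And>i. i < n \<Longrightarrow> M i \<subseteq> verts G \<and> M i \<noteq> {} \<and> connected_set G (M i)"
    and "\<And>i j. i < n \<Longrightarrow> j < n \<Longrightarrow> i \<noteq> j \<Longrightarrow> M i \<inter> M j = {} \<and> (\<exists>u\<in>M i. \<exists>v\<in>M j. adj G u v)"
proof -
  from assms obtain M where M: "\<forall>i<n. M i \<subseteq> verts G \<and> M i \<noteq> {} \<and> connected_set G (M i)"
    "\<forall>i<n. \<forall>j<n. i \<noteq> j \<longrightarrow> M i \<inter> M j = {} \<and> (\<exists>u\<in>M i. \<exists>v\<in>M j. adj G u v)"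
    unfolding clique_minor_def by (elim exE conjE)
  show thesis using M by (intro that[of M]) simp_all
qed

lemma clique_minor_mono:
  assumes "contains H G" "clique_minor G n"
  shows "clique_minor H n"
proof -
  obtain f where f: "inj_on f (verts G)" "\<And>u. u \<in> verts G \<Longrightarrow> f u \<in> verts H"
    "\<And>u v. u \<in> verts G \<Longrightarrow> v \<in> verts G \<Longrightarrow> adj G u v \<Longrightarrow> adj H (f u) (f v)"
    by (rule containsE[OF assms(1)]) (rule that)
  obtain M where M: "\<And>i. i < n \<Longrightarrow> M i \<subseteq> verts G \<and> M i \<noteq> {} \<and> connected_set G (M i)"
    "\<And>i j. i < n \<Longrightarrow> j < n \<Longrightarrow> i \<noteq> j \<Longrightarrow> M i \<inter> M j = {} \<and> (\<exists>u\<in>M i. \<exists>v\<in>M j. adj G u v)"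
    by (rule clique_minorE[OF assms(2)]) (rule that)
  show ?thesis
    unfolding clique_minor_def
  proof (intro exI[of _ "\<lambda>i. f ` M i"] conjI allI impI)
    fix i assume i: "i < n"
    show "f ` M i \<subseteq> verts H" "f ` M i \<noteq> {}" using M(1)[OF i] f(2) by auto
    show "connected_set H (f ` M i)"
      using M(1)[OF i] f(3) by (intro connected_set_image[of G]) auto
    fix j assume j: "j < n" "i \<noteq> j"
    have sub: "M i \<subseteq> verts G" "M j \<subseteq> verts G" using M(1) i j by auto
    show "f ` M i \<inter> f ` M j = {}"
      using M(2)[OF i j] inj_on_image_Int[OF f(1) sub] by auto
    show "\<exists>u\<in>f ` M i. \<exists>v\<in>f ` M j. adj H u v"
      using M(2)[OF i j] sub f(3) by blast
  qed
qed

lemma is_tree_singleton: "is_tree \<lparr>verts = {t}, edges = {}\<rparr>"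
  by (simp add: is_tree_def sgraph_def connected_def connected_set_def)

lemma tree_decomposition_trivial:
  assumes "sgraph G"
  shows "tree_decomposition G \<lparr>verts = {0}, edges = {}\<rparr> (\<lambda>_. verts G)"
  using edge_ends[OF assms]
  by (fastforce simp: tree_decomposition_def is_tree_singleton connected_set_def)

text \<open>The one-bag decomposition makes the set under \<open>LEAST\<close> nonempty, so the
  minimum is attained.\<close>

lemma treewidth_attained:
  assumes "sgraph G"
  obtains T B where "tree_decomposition G T B" "\<And>t. t \<in> verts T \<Longrightarrow> card (B t) \<le> treewidth G + 1"
proof -
  have "\<exists>k T B. tree_decomposition G T B \<and> (\<forall>t\<in>verts T. card (B t) \<le> k + 1)"
    using tree_decomposition_trivial[OF assms]
    by (intro exI[of _ "card (verts G)"]) (metis le_add1)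
  then have "\<exists>T B. tree_decomposition G T B \<and> (\<forall>t\<in>verts T. card (B t) \<le> treewidth G + 1)"
    unfolding treewidth_def by (rule LeastI_ex)
  with that show thesis by blast
qed

lemma treewidth_le:
  "tree_decomposition G T B \<Longrightarrow> (\<And>t. t \<in> verts T \<Longrightarrow> card (B t) \<le> k + 1) \<Longrightarrow> treewidth G \<le> k"
  unfolding treewidth_def by (rule Least_le) blast

text \<open>Each edge inside \<open>M\<close> lies in a common bag, so the subtrees belonging to
  consecutive vertices of a walk in \<open>M\<close> overlap.\<close>

lemma connected_set_bags:
  assumes td: "tree_decomposition G T B" and M: "M \<subseteq> verts G" "connected_set G M"
  shows "connected_set T {t \<in> verts T. B t \<inter> M \<noteq> {}}" (is "connected_set T ?X")
  unfolding connected_set_def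
proof (intro ballI)
  fix t t' assume "t \<in> ?X" "t' \<in> ?X"
  then obtain v v' where v: "t \<in> verts T" "v \<in> B t" "v \<in> M" "t' \<in> verts T" "v' \<in> B t'" "v' \<in> M"
    by blast
  have bag: "reach T ?X s s'" if "w \<in> M" "s \<in> verts T" "s' \<in> verts T" "w \<in> B s" "w \<in> B s'" for w s s'
  proof -
    have "connected_set T {t \<in> verts T. w \<in> B t}"
      using td that(1) M(1) by (auto simp: tree_decomposition_def)
    then have "reach T {t \<in> verts T. w \<in> B t} s s'"
      by (rule connected_setD) (use that in auto)
    then show ?thesis by (rule reach_mono) (use that in auto)
  qed
  have "reach G M v v'" using M(2) v by (simp add: connected_setD)
  \<comment> \<open>The claim covers all bags of the current vertex, since the bag shared with the
    next vertex may differ from the one by which the walk arrived.\<close>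
  then have "\<forall>t'\<in>verts T. v' \<in> B t' \<longrightarrow> reach T ?X t t'"
  proof (induction rule: rtranclp_induct)
    case base
    then show ?case using bag v by blast
  next
    case (step y z)
    obtain s where s: "s \<in> verts T" "{y, z} \<subseteq> B s"
      using td step.hyps(2) by (auto simp: tree_decomposition_def adj_def)
    show ?case
    proof (intro ballI impI)
      fix t' assume t': "t' \<in> verts T" "z \<in> B t'"
      have "reach T ?X t s" using step.IH s by auto
      moreover have "reach T ?X s t'" using bag[of z s t'] s t' step.hyps(2) by auto
      ultimately show "reach T ?X t t'" by (rule rtranclp_trans)
    qed
  qed
  with v show "reach T ?X t t'" by blast
qed

text \<open>The bags meeting a branch set form a subtree, and adjacent branch sets share a bag. By
  the Helly property one bag meets all \<open>n\<close> branch sets; these are disjoint, so it has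
  at least \<open>n\<close> elements.\<close>

lemma clique_minor_le_treewidth:
  assumes sg: "sgraph G" and "clique_minor G n"
  shows "n \<le> treewidth G + 1"
proof -
  obtain T B where td: "tree_decomposition G T B"
    and width: "\<And>t. t \<in> verts T \<Longrightarrow> card (B t) \<le> treewidth G + 1"
    by (rule treewidth_attained[OF sg]) (rule that)
  obtain M where M: "\<And>i. i < n \<Longrightarrow> M i \<subseteq> verts G \<and> M i \<noteq> {} \<and> connected_set G (M i)"
    "\<And>i j. i < n \<Longrightarrow> j < n \<Longrightarrow> i \<noteq> j \<Longrightarrow> M i \<inter> M j = {} \<and> (\<exists>u\<in>M i. \<exists>v\<in>M j. adj G u v)"
    by (rule clique_minorE[OF assms(2)]) (rule that)
  define X where "X i = {t \<in> verts T. B t \<inter> M i \<noteq> {}}" for i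
  have "\<exists>t\<in>verts T. \<forall>i\<in>{..<n}. t \<in> X i"
  proof (rule subtree_Helly)
    show "is_tree T" using td by (simp add: tree_decomposition_def)
    show "X i \<subseteq> verts T" for i by (auto simp: X_def)
    show "connected_set T (X i)" if "i \<in> {..<n}" for i
      unfolding X_def using that M(1) by (intro connected_set_bags[OF td]) auto
    show "X i \<inter> X j \<noteq> {}" if ij: "i \<in> {..<n}" "j \<in> {..<n}" for i j
    proof (cases "i = j")
      case True
      obtain v where "v \<in> M i" "v \<in> verts G" using M(1) ij by blast
      moreover from this obtain t where "t \<in> verts T" "v \<in> B t"
        using td by (auto simp: tree_decomposition_def)
      ultimately show ?thesis using True by (auto simp: X_def)
    next
      case False
      then obtain u v where uv: "u \<in> M i" "v \<in> M j" "adj G u v" using M(2) ij by fast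
      then obtain t where "t \<in> verts T" "{u, v} \<subseteq> B t"
        using td by (auto simp: tree_decomposition_def adj_def)
      with uv show ?thesis by (auto simp: X_def)
    qed
  qed
  then obtain t where t: "t \<in> verts T" "\<And>i. i < n \<Longrightarrow> B t \<inter> M i \<noteq> {}"
    by (auto simp: X_def)
  then have "\<forall>i. \<exists>v. i < n \<longrightarrow> v \<in> B t \<inter> M i" by blast
  then obtain r where r: "\<And>i. i < n \<Longrightarrow> r i \<in> B t \<inter> M i" by metis
  have "inj_on r {..<n}"
  proof (rule inj_onI, rule ccontr)
    fix i j assume ij: "i \<in> {..<n}" "j \<in> {..<n}" "r i = r j" "i \<noteq> j"
    then show False using M(2)[of i j] r[of i] r[of j] by auto
  qed
  moreover have "r ` {..<n} \<subseteq> B t" using r by auto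
  moreover have "finite (B t)"
    using td t(1) sg by (auto simp: tree_decomposition_def sgraph_def intro: finite_subset)
  ultimately have "card {..<n} \<le> card (B t)" by (rule card_inj_on_le)
  with width[OF t(1)] show ?thesis by simp
qed

section \<open>Cores\<close>

lemma is_tree_add_leaf:
  assumes T: "is_tree T" and t: "t \<notin> verts T" and s: "s \<in> verts T"
  shows "is_tree \<lparr>verts = insert t (verts T), edges = insert {t, s} (edges T)\<rparr>" (is "is_tree ?T")
proof -
  have sg: "sgraph T" and co: "connected T" and ca: "card (edges T) + 1 = card (verts T)"
    using T by (auto simp: is_tree_def)
  have fin: "finite (verts T)" using sg by (simp add: sgraph_def)
  have "{t, s} \<notin> edges T" using adjD(1)[OF sg, of t s] t by (auto simp: adj_def)
  then have "card (edges ?T) + 1 = card (verts ?T)"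
    using ca fin t finite_edges[OF sg] by simp
  moreover have "sgraph ?T"
    unfolding sgraph_def
  proof (intro conjI ballI)
    show "finite (verts ?T)" using fin by simp
    fix e assume "e \<in> edges ?T"
    then consider "e = {t, s}" | "e \<in> edges T" by auto
    then show "\<exists>u v. u \<in> verts ?T \<and> v \<in> verts ?T \<and> u \<noteq> v \<and> e = {u, v}"
    proof cases
      case 1
      then show ?thesis using s t by (intro exI[of _ t] exI[of _ s]) auto
    next
      case 2
      then obtain u v where "e = {u, v}" "u \<in> verts T" "v \<in> verts T" "u \<noteq> v"
        using edge_ends[OF sg] by blast
      then show ?thesis by (intro exI[of _ u] exI[of _ v]) auto
    qed
  qed
  moreover have "connected_set ?T (verts ?T)"
  proof (rule connected_setI)
    fix x assume x: "x \<in> verts ?T"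
    show "reach ?T (verts ?T) x s"
    proof (cases "x = t")
      case True
      then show ?thesis using s by (intro r_into_rtranclp) (simp add: adj_def)
    next
      case False
      then have "x \<in> verts T" using x by simp
      then have "reach T (verts T) x s"
        using co s by (simp add: connected_def connected_setD)
      then show ?thesis
        using reach_image[where f = "\<lambda>x. x" and G = T and S = "verts T" and H = ?T and S' = "verts ?T"]
        by (auto simp: adj_def)
    qed
  qed
  ultimately show ?thesis by (simp add: is_tree_def connected_def)
qed

text \<open>The new bag consists of \<open>v\<close> and its neighbour, if there is one, whence
  \<open>2 \<le> m\<close>. It is hung on a bag that contains the neighbour, so the occurrences of
  the neighbour stay connected.\<close>

lemma tree_decomposition_add_pendant:
  assumes sg: "sgraph F" and v: "v \<in> verts F" "degree F v \<le> 1" and m: "2 \<le> m"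
    and td: "tree_decomposition (delete_vertex F v) T B" and w: "\<And>t. t \<in> verts T \<Longrightarrow> card (B t) \<le> m"
  shows "\<exists>T B. tree_decomposition F T B \<and> (\<forall>t\<in>verts T. card (B t) \<le> m)"
proof -
  let ?F = "delete_vertex F v"
  have T: "is_tree T" and B: "\<And>t. t \<in> verts T \<Longrightarrow> B t \<subseteq> verts F - {v}"
    and cover: "\<And>x. x \<in> verts F - {v} \<Longrightarrow> \<exists>t\<in>verts T. x \<in> B t"
    and edge: "\<And>e. e \<in> edges ?F \<Longrightarrow> \<exists>t\<in>verts T. e \<subseteq> B t"
    and conn: "\<And>x. x \<in> verts F - {v} \<Longrightarrow> connected_set T {t \<in> verts T. x \<in> B t}"
    using td by (auto simp: tree_decomposition_def)
  have finT: "finite (verts T)" and neT: "verts T \<noteq> {}"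
    using T by (auto simp: is_tree_def sgraph_def connected_def)
  have fin: "finite (verts F)" using sg by (simp add: sgraph_def)
  obtain t where t: "t \<notin> verts T" using finT ex_new_if_finite[OF infinite_UNIV_nat] by blast
  obtain N where N: "N = {u \<in> verts F. adj F v u}" by blast
  have vN: "v \<notin> N" using adjD(3)[OF sg, of v v] by (auto simp: N)
  have cN: "card N \<le> 1" "finite N" using v fin by (auto simp: N degree_def)
  obtain s where s: "s \<in> verts T" "N \<subseteq> B s"
  proof (cases "N = {}")
    case True
    obtain s where "s \<in> verts T" using neT by blast
    then show thesis by (rule that) (use True in simp)
  next
    case False
    then have "card N = 1" using cN by (metis card_0_eq le_less_Suc_eq less_one order_le_less One_nat_def)
    then obtain u where u: "N = {u}" by (auto simp: card_1_singleton_iff)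
    have "u \<in> verts F - {v}" using u vN N by auto
    from cover[OF this] obtain s where "s \<in> verts T" "u \<in> B s" by blast
    then show thesis using u by (intro that[of s]) auto
  qed
  let ?T = "\<lparr>verts = insert t (verts T), edges = insert {t, s} (edges T)\<rparr>"
  let ?B = "B(t := insert v N)"
  \<comment> \<open>Only \<open>v\<close> and its neighbour gain the new node among their
    occurrences.\<close>
  have bags: "{r \<in> verts ?T. x \<in> ?B r} = {r \<in> verts T. x \<in> B r} \<union> (if x \<in> insert v N then {t} else {})" for x
    using t by auto
  have ext: "reach ?T S' x y" if "reach T S x y" "S \<subseteq> S'" for S S' x y
    using reach_image[where f = "\<lambda>x. x" and G = T and S = S and H = ?T and S' = S'] that
    by (auto simp: adj_def)
  have "tree_decomposition F ?T ?B"
    unfolding tree_decomposition_def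
  proof (intro conjI ballI)
    show "is_tree ?T" using T t s(1) by (rule is_tree_add_leaf)
    show "?B r \<subseteq> verts F" if "r \<in> verts ?T" for r
      using that B v N by auto
    show "\<exists>r\<in>verts ?T. x \<in> ?B r" if x: "x \<in> verts F" for x
    proof (cases "x = v")
      case False
      then obtain r where "r \<in> verts T" "x \<in> B r" using cover[of x] x by auto
      then show ?thesis using t by (intro bexI[of _ r]) auto
    qed (auto intro: bexI[of _ t])
    show "\<exists>r\<in>verts ?T. e \<subseteq> ?B r" if e: "e \<in> edges F" for e
    proof (cases "v \<in> e")
      case True
      obtain a b where "e = {a, b}" "adj F a b" "a \<in> verts F" "b \<in> verts F"
        using edge_ends[OF sg e] by blast
      then have "e \<subseteq> insert v N" using True adj_sym[of F a b] by (auto simp: N)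
      then show ?thesis by (intro bexI[of _ t]) auto
    next
      case False
      then obtain r where "r \<in> verts T" "e \<subseteq> B r"
        using edge[of e] e by (auto simp: delete_vertex_def)
      then show ?thesis using t by (intro bexI[of _ r]) auto
    qed
    show "connected_set ?T {r \<in> verts ?T. x \<in> ?B r}" if x: "x \<in> verts F" for x
    proof (cases "x = v")
      case True
      then have "{r \<in> verts ?T. x \<in> ?B r} = {t}" using B t by auto
      then show ?thesis by (simp only:) (simp add: connected_set_def)
    next
      case False
      let ?X = "{r \<in> verts T. x \<in> B r}"
      have cX: "connected_set T ?X" using conn[of x] x False by simp
      show ?thesis
      proof (cases "x \<in> N")
        case xN: True
        have sX: "s \<in> ?X" using xN s by auto
        have "connected_set ?T (insert t ?X)"
        proof (rule connected_setI)
          fix r assume r: "r \<in> insert t ?X"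
          show "reach ?T (insert t ?X) r s"
          proof (cases "r = t")
            case True
            then show ?thesis using sX by (intro r_into_rtranclp) (auto simp: adj_def)
          next
            case False
            then have "reach T ?X r s" using r by (intro connected_setD[OF cX _ sX]) auto
            then show ?thesis by (rule ext) auto
          qed
        qed
        then show ?thesis unfolding bags using xN by simp
      next
        case xN: False
        have "connected_set ?T ?X"
          unfolding connected_set_def
        proof (intro ballI)
          fix a b assume "a \<in> ?X" "b \<in> ?X"
          then have "reach T ?X a b" by (rule connected_setD[OF cX])
          then show "reach ?T ?X a b" by (rule ext) simp
        qed
        then show ?thesis unfolding bags using xN False by simp
      qed
    qed
  qed
  moreover have "card (?B r) \<le> m" if "r \<in> verts ?T" for r
    using that w m cN vN by auto
  ultimately show ?thesis by blast
qed

lemma sgraph_peel: "peel F H \<Longrightarrow> sgraph F \<Longrightarrow> sgraph H"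
  by (auto simp: peel_def sgraph_delete_vertex)

text \<open>The induction undoes the peeling, starting with all of \<open>F0\<close> in one bag. It
  counts bag sizes instead of widths, so that an empty core causes no trouble with
  subtraction.\<close>

lemma treewidth_le_core:
  assumes "peel\<^sup>*\<^sup>* F F0" "sgraph F"
  shows "treewidth F + 1 \<le> max 2 (card (verts F0))"
proof -
  let ?m = "max 2 (card (verts F0))"
  have "\<exists>T B. tree_decomposition F T B \<and> (\<forall>t\<in>verts T. card (B t) \<le> ?m)"
    using assms
  proof (induction rule: converse_rtranclp_induct)
    case base
    then show ?case using tree_decomposition_trivial by fastforce
  next
    case (step F H)
    obtain v where v: "v \<in> verts F" "degree F v \<le> 1" "H = delete_vertex F v"
      using step.hyps(1) by (auto simp: peel_def)
    obtain T B where "tree_decomposition H T B" "\<forall>t\<in>verts T. card (B t) \<le> ?m"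
      using step.IH sgraph_peel[OF step.hyps(1) step.prems] by blast
    then show ?case
      using tree_decomposition_add_pendant[OF step.prems v(1,2), of ?m T B] v(3) by auto
  qed
  then obtain T B where "tree_decomposition F T B" "\<forall>t\<in>verts T. card (B t) \<le> ?m" by blast
  then have "treewidth F \<le> ?m - 1" by (intro treewidth_le) auto
  then show ?thesis by linarith
qed

lemma core_exists:
  assumes "sgraph F"
  shows "\<exists>F0. is_core F F0"
  using assms
proof (induction "card (verts F)" arbitrary: F rule: less_induct)
  case less
  show ?case
  proof (cases "\<exists>v\<in>verts F. degree F v \<le> 1")
    case True
    then obtain v where v: "v \<in> verts F" "degree F v \<le> 1" by blast
    have "card (verts (delete_vertex F v)) < card (verts F)"
      using card_Diff1_less[of "verts F" v] less.prems v by (simp add: sgraph_def)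
    then obtain F0 where "is_core (delete_vertex F v) F0"
      using less.hyps sgraph_delete_vertex[OF less.prems] by blast
    moreover have "peel F (delete_vertex F v)" using v by (auto simp: peel_def)
    ultimately have "is_core F F0"
      by (auto simp: is_core_def intro: converse_rtranclp_into_rtranclp)
    then show ?thesis by blast
  next
    case False
    then have "is_core F F" by (auto simp: is_core_def)
    then show ?thesis by blast
  qed
qed

section \<open>Finite-variable logic\<close>

lemma finite_vars: "finite (vars \<phi>)"
  by (induction \<phi>) auto

lemma free_vars_subset_vars: "free_vars \<phi> \<subseteq> vars \<phi>"
  by (induction \<phi>) auto

text \<open>\<open>D\<close> is the set of variables that carry a pebble. Quantifying a variable
  again first lifts its pebble, so \<open>zig\<close> and \<open>zag\<close> concern only
  \<open>x \<notin> D\<close>, and \<open>insert x D \<subseteq> X\<close> limits the number of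
  pebbles by \<open>card X\<close> when \<open>X\<close> is finite.\<close>

lemma sat_back_and_forth:
  fixes G :: "'a sgraph" and H :: "'b sgraph"
    and inv :: "nat set \<Rightarrow> (nat \<Rightarrow> 'a) \<Rightarrow> (nat \<Rightarrow> 'b) \<Rightarrow> bool"
  assumes mono: "\<And>D D' \<alpha> \<beta>. inv D \<alpha> \<beta> \<Longrightarrow> D' \<subseteq> D \<Longrightarrow> inv D' \<alpha> \<beta>"
    and adj: "\<And>D \<alpha> \<beta> x y. inv D \<alpha> \<beta> \<Longrightarrow> x \<in> D \<Longrightarrow> y \<in> D \<Longrightarrow> D \<subseteq> X \<Longrightarrow>
      adj G (\<alpha> x) (\<alpha> y) \<longleftrightarrow> adj H (\<beta> x) (\<beta> y)"
    and eq: "\<And>D \<alpha> \<beta> x y. inv D \<alpha> \<beta> \<Longrightarrow> x \<in> D \<Longrightarrow> y \<in> D \<Longrightarrow> D \<subseteq> X \<Longrightarrow> \<alpha> x = \<alpha> y \<longleftrightarrow> \<beta> x = \<beta> y"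
    and zig: "\<And>D \<alpha> \<beta> x v. inv D \<alpha> \<beta> \<Longrightarrow> insert x D \<subseteq> X \<Longrightarrow> x \<notin> D \<Longrightarrow> v \<in> verts G \<Longrightarrow>
      \<exists>w\<in>verts H. inv (insert x D) (\<alpha>(x := v)) (\<beta>(x := w))"
    and zag: "\<And>D \<alpha> \<beta> x w. inv D \<alpha> \<beta> \<Longrightarrow> insert x D \<subseteq> X \<Longrightarrow> x \<notin> D \<Longrightarrow> w \<in> verts H \<Longrightarrow>
      \<exists>v\<in>verts G. inv (insert x D) (\<alpha>(x := v)) (\<beta>(x := w))"
  shows "vars \<phi> \<subseteq> X \<Longrightarrow> inv (free_vars \<phi>) \<alpha> \<beta> \<Longrightarrow> sat G \<alpha> \<phi> \<longleftrightarrow> sat H \<beta> \<phi>"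
proof (induction \<phi> arbitrary: \<alpha> \<beta>)
  case (Adj x y)
  then show ?case using adj[of "{x, y}" \<alpha> \<beta> x y] by simp
next
  case (Eq x y)
  then show ?case using eq[of "{x, y}" \<alpha> \<beta> x y] by simp
next
  case (Conj \<phi> \<psi>)
  have "inv (free_vars \<phi>) \<alpha> \<beta>" "inv (free_vars \<psi>) \<alpha> \<beta>"
    using mono[OF Conj.prems(2)] by auto
  then show ?case using Conj by simp
next
  case (Ex x \<phi>)
  let ?D = "free_vars \<phi> - {x}"
  have D: "inv ?D \<alpha> \<beta>" "insert x ?D \<subseteq> X" "x \<notin> ?D"
    using Ex.prems free_vars_subset_vars[of \<phi>] by auto
  have IH: "sat G (\<alpha>(x := v)) \<phi> \<longleftrightarrow> sat H (\<beta>(x := w)) \<phi>"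
    if "inv (insert x ?D) (\<alpha>(x := v)) (\<beta>(x := w))" for v w
  proof (rule Ex.IH)
    show "vars \<phi> \<subseteq> X" using Ex.prems(1) by simp
    show "inv (free_vars \<phi>) (\<alpha>(x := v)) (\<beta>(x := w))" using that by (rule mono) auto
  qed
  show ?case
  proof
    assume "sat G \<alpha> (Ex x \<phi>)"
    then obtain v where v: "v \<in> verts G" "sat G (\<alpha>(x := v)) \<phi>" by auto
    from zig[OF D v(1)] obtain w
      where "w \<in> verts H" "inv (insert x ?D) (\<alpha>(x := v)) (\<beta>(x := w))" by blast
    with IH v(2) show "sat H \<beta> (Ex x \<phi>)" by auto
  next
    assume "sat H \<beta> (Ex x \<phi>)"
    then obtain w where w: "w \<in> verts H" "sat H (\<beta>(x := w)) \<phi>" by auto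
    from zag[OF D w(1)] obtain v
      where "v \<in> verts G" "inv (insert x ?D) (\<alpha>(x := v)) (\<beta>(x := w))" by blast
    with IH w(2) show "sat G \<alpha> (Ex x \<phi>)" by auto
  qed
qed auto

text \<open>\<open>models\<close> starts from the value \<open>undefined\<close>, which may lie
  outside the graph. For a sentence the game starts with no pebbles, so the invariant is vacuous
  there.\<close>

lemma models_isomorphic:
  assumes f: "bij_betw f (verts G) (verts H)"
    and adj: "\<And>u v. u \<in> verts G \<Longrightarrow> v \<in> verts G \<Longrightarrow> adj G u v \<longleftrightarrow> adj H (f u) (f v)"
    and "sentence \<phi>"
  shows "models G \<phi> \<longleftrightarrow> models H \<phi>"
  unfolding models_def
proof (rule sat_back_and_forth[where X = UNIV
      and inv = "\<lambda>D \<alpha> \<beta>. \<forall>x\<in>D. \<alpha> x \<in> verts G \<and> \<beta> x = f (\<alpha> x)"])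
  fix D :: "nat set" and \<alpha> \<beta> x y
  assume inv: "\<forall>x\<in>D. \<alpha> x \<in> verts G \<and> \<beta> x = f (\<alpha> x)"
  show "adj G (\<alpha> x) (\<alpha> y) \<longleftrightarrow> adj H (\<beta> x) (\<beta> y)" if "x \<in> D" "y \<in> D"
    using inv that adj by simp
  show "\<alpha> x = \<alpha> y \<longleftrightarrow> \<beta> x = \<beta> y" if "x \<in> D" "y \<in> D"
    using inv that f by (auto simp: bij_betw_def inj_on_eq_iff)
  assume x: "x \<notin> D"
  show "\<exists>w\<in>verts H. \<forall>z\<in>insert x D. (\<alpha>(x := v)) z \<in> verts G \<and> (\<beta>(x := w)) z = f ((\<alpha>(x := v)) z)"
    if "v \<in> verts G" for v
    using that inv x f by (intro bexI[of _ "f v"]) (auto simp: bij_betw_def)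
  show "\<exists>v\<in>verts G. \<forall>z\<in>insert x D. (\<alpha>(x := v)) z \<in> verts G \<and> (\<beta>(x := w)) z = f ((\<alpha>(x := v)) z)"
    if w: "w \<in> verts H" for w
  proof -
    obtain v where "v \<in> verts G" "w = f v" using w f by (auto simp: bij_betw_def)
    then show ?thesis using inv x by (intro bexI[of _ v]) auto
  qed
qed (use assms(3) in \<open>auto simp: sentence_def\<close>)

text \<open>With a single variable all atoms are of the form \<open>Adj x x\<close> or
  \<open>Eq x x\<close>, whose truth values are the same in all simple graphs; any vertex is then a
  good answer.\<close>

lemma models_one_variable:
  assumes "sgraph G" "sgraph H" "verts G \<noteq> {}" "verts H \<noteq> {}"
    and "sentence \<phi>" "var_width \<phi> \<le> 1"
  shows "models G \<phi> \<longleftrightarrow> models H \<phi>"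
  unfolding models_def
proof (rule sat_back_and_forth[where X = "vars \<phi>" and inv = "\<lambda>D \<alpha> \<beta>. True"])
  have single: "x = y" if "x \<in> vars \<phi>" "y \<in> vars \<phi>" for x y
    using assms(6) that finite_vars[of \<phi>] card_le_Suc0_iff_eq[of "vars \<phi>"] by (auto simp: var_width_def)
  fix D :: "nat set" and \<alpha> \<beta> x y assume D: "x \<in> D" "y \<in> D" "D \<subseteq> vars \<phi>"
  then have "x = y" using single by blast
  then show "adj G (\<alpha> x) (\<alpha> y) \<longleftrightarrow> adj H (\<beta> x) (\<beta> y)" "\<alpha> x = \<alpha> y \<longleftrightarrow> \<beta> x = \<beta> y"
    using adjD(3)[OF assms(1)] adjD(3)[OF assms(2)] by blast+
qed (use assms in auto)

text \<open>\<open>W_tw\<close> quantifies over hosts on \<open>nat\<close>, whereas the hosts below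
  live on products and sums. The containment \<open>contains G' G\<close> carries minors and copies
  of \<open>F\<close> into the new host, the other one carries a copy of \<open>F\<close>
  back.\<close>

lemma nat_copy:
  assumes sg: "sgraph G" and co: "connected G"
  obtains G' :: "nat sgraph" where "sgraph G'" "connected G'" "contains G' G" "contains G G'"
    "\<And>\<phi>. sentence \<phi> \<Longrightarrow> models G' \<phi> \<longleftrightarrow> models G \<phi>"
proof -
  have fin: "finite (verts G)" using sg by (simp add: sgraph_def)
  then obtain f :: "_ \<Rightarrow> nat" where f: "inj_on f (verts G)"
    using finite_imp_inj_to_nat_seg by blast
  define g where "g = inv_into (verts G) f"
  have gf: "g (f u) = u" if "u \<in> verts G" for u using f that by (simp add: g_def)
  define G' where "G' = rel_graph (f ` verts G) (\<lambda>x y. adj G (g x) (g y))"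
  have adj': "adj G' (f u) (f v) \<longleftrightarrow> adj G u v" if "u \<in> verts G" "v \<in> verts G" for u v
    using that gf adj_sym[of G] adjD(3)[OF sg, of u v] inj_on_eq_iff[OF f]
    by (auto simp: G'_def adj_rel_graph)
  have V: "verts G' = f ` verts G" by (simp add: G'_def)
  show thesis
  proof (rule that[of G'])
    show "sgraph G'" unfolding G'_def using fin by (intro sgraph_rel_graph) simp
    have "connected_set G' (f ` verts G)"
      using co adj' by (intro connected_set_image[of G]) (auto simp: connected_def)
    then show "connected G'" using co by (simp add: connected_def V)
    show "contains G' G" using f adj' by (intro containsI[of f]) (auto simp: V)
    show "contains G G'" by (rule containsI[of g]) (auto simp: V gf adj' inj_on_def)
    show "models G' \<phi> \<longleftrightarrow> models G \<phi>" if "sentence \<phi>" for \<phi>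
      using models_isomorphic[of f G G' \<phi>] f adj' that by (simp add: bij_betw_def V)
  qed
qed

section \<open>Subgraph containment is first-order definable\<close>

lemma free_vars_foldr_Ex: "free_vars (foldr Ex xs \<phi>) = free_vars \<phi> - set xs"
  by (induction xs) auto

lemma free_vars_foldr_Conj: "free_vars (foldr Conj \<phi>s FTrue) = (\<Union>\<phi>\<in>set \<phi>s. free_vars \<phi>)"
  by (induction \<phi>s) auto

lemma sat_foldr_Conj: "sat G \<alpha> (foldr Conj \<phi>s FTrue) \<longleftrightarrow> (\<forall>\<phi>\<in>set \<phi>s. sat G \<alpha> \<phi>)"
  by (induction \<phi>s) auto

lemma sat_foldr_Ex:
  "sat G \<alpha> (foldr Ex xs \<phi>) \<longleftrightarrow>
    (\<exists>\<beta>. (\<forall>x. x \<notin> set xs \<longrightarrow> \<beta> x = \<alpha> x) \<and> (\<forall>x\<in>set xs. \<beta> x \<in> verts G) \<and> sat G \<beta> \<phi>)"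
proof (induction xs arbitrary: \<alpha>)
  case Nil
  have "\<beta> = \<alpha>" if "\<forall>x. \<beta> x = \<alpha> x" for \<beta> using that by auto
  then show ?case by auto
next
  case (Cons x xs)
  show ?case
  proof
    assume "sat G \<alpha> (foldr Ex (x # xs) \<phi>)"
    then obtain v where v: "v \<in> verts G" "sat G (\<alpha>(x := v)) (foldr Ex xs \<phi>)" by auto
    then obtain \<beta> where b: "\<forall>y. y \<notin> set xs \<longrightarrow> \<beta> y = (\<alpha>(x := v)) y" "\<forall>y\<in>set xs. \<beta> y \<in> verts G" "sat G \<beta> \<phi>"
      using Cons by blast
    \<comment> \<open>If \<open>x\<close> occurs again in \<open>xs\<close>, its final value is set
      by that inner quantifier and not by \<open>v\<close>.\<close>
    have "\<beta> x \<in> verts G" using b(1,2) v(1) by (cases "x \<in> set xs") auto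
    with b show "\<exists>\<beta>. (\<forall>y. y \<notin> set (x # xs) \<longrightarrow> \<beta> y = \<alpha> y) \<and> (\<forall>y\<in>set (x # xs). \<beta> y \<in> verts G) \<and> sat G \<beta> \<phi>"
      by (intro exI[of _ \<beta>]) auto
  next
    assume "\<exists>\<beta>. (\<forall>y. y \<notin> set (x # xs) \<longrightarrow> \<beta> y = \<alpha> y) \<and> (\<forall>y\<in>set (x # xs). \<beta> y \<in> verts G) \<and> sat G \<beta> \<phi>"
    then obtain \<beta> where b: "\<forall>y. y \<notin> set (x # xs) \<longrightarrow> \<beta> y = \<alpha> y" "\<forall>y\<in>set (x # xs). \<beta> y \<in> verts G" "sat G \<beta> \<phi>"
      by blast
    have "sat G (\<alpha>(x := \<beta> x)) (foldr Ex xs \<phi>)"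
      unfolding Cons.IH using b by (intro exI[of _ \<beta>]) auto
    then show "sat G \<alpha> (foldr Ex (x # xs) \<phi>)" using b(2) by auto
  qed
qed

text \<open>The sentence has one variable per vertex of \<open>F\<close> and quantifies
  existentially over the conjunction of all required edges and inequalities.\<close>

lemma contains_definable:
  fixes F :: "'a sgraph"
  assumes "sgraph F"
  shows "\<exists>\<phi>. sentence \<phi> \<and> (\<forall>G :: nat sgraph. models G \<phi> \<longleftrightarrow> contains G F)"
proof -
  have "finite (verts F)" using assms by (simp add: sgraph_def)
  then obtain us where us: "set us = verts F" using finite_list by blast
  obtain h :: "'a \<Rightarrow> nat" where h: "inj_on h (verts F)"
    using finite_imp_inj_to_nat_seg[OF \<open>finite (verts F)\<close>] by blast
  define lit where "lit u v = (if u = v then FTrue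
    else if adj F u v then Conj (Neg (Eq (h u) (h v))) (Adj (h u) (h v))
    else Neg (Eq (h u) (h v)))" for u v
  define lits where "lits = concat (map (\<lambda>u. map (lit u) us) us)"
  have lits: "set lits = {lit u v | u v. u \<in> verts F \<and> v \<in> verts F}"
    by (auto simp: lits_def us)
  define \<phi> where "\<phi> = foldr Ex (map h us) (foldr Conj lits FTrue)"
  have "free_vars \<psi> \<subseteq> h ` verts F" if "\<psi> \<in> set lits" for \<psi>
    using that by (auto simp: lits lit_def split: if_splits)
  then have "sentence \<phi>"
    by (auto simp: sentence_def \<phi>_def free_vars_foldr_Ex free_vars_foldr_Conj us)
  moreover have "models G \<phi> \<longleftrightarrow> contains G F" for G :: "nat sgraph"
  proof
    assume "models G \<phi>"
    then obtain \<beta> where b: "\<forall>x\<in>h ` verts F. \<beta> x \<in> verts G" "\<forall>\<psi>\<in>set lits. sat G \<beta> \<psi>"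
      unfolding models_def \<phi>_def sat_foldr_Ex sat_foldr_Conj by (auto simp: us)
    have lit: "\<beta> (h u) \<noteq> \<beta> (h v) \<and> (adj F u v \<longrightarrow> adj G (\<beta> (h u)) (\<beta> (h v)))"
      if "u \<in> verts F" "v \<in> verts F" "u \<noteq> v" for u v
    proof -
      have "sat G \<beta> (lit u v)" using b(2) that lits by blast
      then show ?thesis using that(3) by (auto simp: lit_def split: if_splits)
    qed
    show "contains G F"
    proof (rule containsI[of "\<lambda>u. \<beta> (h u)"])
      show "inj_on (\<lambda>u. \<beta> (h u)) (verts F)" using lit by (meson inj_onI)
      show "\<beta> (h u) \<in> verts G" if "u \<in> verts F" for u using b(1) that by blast
      show "adj G (\<beta> (h u)) (\<beta> (h v))" if "u \<in> verts F" "v \<in> verts F" "adj F u v" for u v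
        using lit[of u v] that adjD(3)[OF assms that(3)] by blast
    qed
  next
    assume "contains G F"
    then obtain f where f: "inj_on f (verts F)" "\<And>u. u \<in> verts F \<Longrightarrow> f u \<in> verts G"
      "\<And>u v. u \<in> verts F \<Longrightarrow> v \<in> verts F \<Longrightarrow> adj F u v \<Longrightarrow> adj G (f u) (f v)"
      by (rule containsE) (rule that)
    \<comment> \<open>Off the quantified variables the value must agree with the assignment used by
      \<open>models\<close>, hence \<open>undefined\<close>.\<close>
    define \<beta> where "\<beta> x = (if x \<in> h ` verts F then f (inv_into (verts F) h x) else undefined)" for x
    have bh: "\<beta> (h u) = f u" if "u \<in> verts F" for u using that h by (simp add: \<beta>_def)
    have "sat G \<beta> \<psi>" if psi: "\<psi> \<in> set lits" for \<psi>
    proof -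
      obtain u v where uv: "u \<in> verts F" "v \<in> verts F" and psi: "\<psi> = lit u v"
        using psi lits by blast
      show ?thesis using uv f(3)[OF uv] inj_on_eq_iff[OF f(1) uv] by (simp add: psi lit_def bh)
    qed
    then show "models G \<phi>"
      unfolding models_def \<phi>_def sat_foldr_Ex sat_foldr_Conj
      using f(2) bh by (intro exI[of _ \<beta>]) (auto simp: us \<beta>_def)
  qed
  ultimately show ?thesis by blast
qed

text \<open>The minimum defining \<^const>\<open>W_tw\<close> is attained because containment is definable at all;
  otherwise \<open>LEAST\<close> would be a junk value.\<close>

lemma W_tw_geI:
  fixes F :: "'a sgraph"
  assumes sg: "sgraph F"
    and fool: "\<And>\<phi> k. sentence \<phi> \<Longrightarrow> var_width \<phi> < m \<Longrightarrow> \<exists>G :: nat sgraph. sgraph G \<and> connected G \<and>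
      treewidth G \<ge> k \<and> \<not> (models G \<phi> \<longleftrightarrow> contains G F)"
  shows "m \<le> W_tw F"
proof -
  let ?P = "\<lambda>n. \<exists>\<phi>. sentence \<phi> \<and> var_width \<phi> = n \<and>
      (\<exists>k. \<forall>G :: nat sgraph. sgraph G \<and> connected G \<and> treewidth G \<ge> k \<longrightarrow>
              (models G \<phi> \<longleftrightarrow> contains G F))"
  have "\<exists>n. ?P n" using contains_definable[OF sg] by blast
  then have "?P (W_tw F)" unfolding W_tw_def by (rule LeastI_ex)
  then obtain \<phi> k where phi: "sentence \<phi>" "var_width \<phi> = W_tw F"
    "\<And>G :: nat sgraph. sgraph G \<Longrightarrow> connected G \<Longrightarrow> treewidth G \<ge> k \<Longrightarrow> models G \<phi> \<longleftrightarrow> contains G F"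
    by blast
  show ?thesis
  proof (rule ccontr)
    assume "\<not> m \<le> W_tw F"
    then have "var_width \<phi> < m" using phi(2) by simp
    with fool[OF phi(1) this, of k] phi(3) show False by blast
  qed
qed

section \<open>Linked megastars\<close>

text \<open>Take one copy of the megastar with three arms of length \<open>L\<close> for every \<open>c = (i, j)\<close> and join
  ends of arms as prescribed by \<open>link\<close>: arms 0 and 1 string the stars of row \<open>i\<close> together, arm 2
  joins \<open>(i, j)\<close> to \<open>(j, i)\<close>. Contracting the rows yields a complete graph, so the treewidth is
  large, but the degrees are at most three and branch vertices are far apart.
  A vertex \<open>(c, a, d)\<close> lies at distance \<open>d\<close> from the centre on arm \<open>a\<close>; the centre is \<open>(c, 0, 0)\<close>.\<close>

definition link :: "nat \<times> nat \<Rightarrow> nat \<Rightarrow> nat \<times> nat \<Rightarrow> nat \<Rightarrow> bool" where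
  "link c a c' a' \<longleftrightarrow>
     a = 1 \<and> a' = 0 \<and> c' = (fst c, Suc (snd c)) \<or>
     a = 0 \<and> a' = 1 \<and> c = (fst c', Suc (snd c')) \<or>
     a = 2 \<and> a' = 2 \<and> c' = (snd c, fst c) \<and> fst c \<noteq> snd c"

lemma link_sym: "link c a c' a' \<Longrightarrow> link c' a' c a"
  by (auto simp: link_def)

lemma link_neq: "link c a c' a' \<Longrightarrow> c \<noteq> c'"
  by (cases c; cases c') (auto simp: link_def)

text \<open>Keeps the degrees low: the end of an arm has at most one neighbour across a link,
  besides the one towards its centre.\<close>

lemma link_unique: "link c a c1 a1 \<Longrightarrow> link c a c2 a2 \<Longrightarrow> c1 = c2 \<and> a1 = a2"
  by (cases c; cases c1; cases c2) (auto simp: link_def)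

type_synonym web_vertex = "(nat \<times> nat) \<times> nat \<times> nat"

definition web_verts :: "nat \<Rightarrow> nat \<Rightarrow> web_vertex set" where
  "web_verts n L = {(c, a, d). c \<in> {..<n} \<times> {..<n} \<and> a < 3 \<and> d \<le> L \<and> (d = 0 \<longrightarrow> a = 0)}"

definition web :: "nat \<Rightarrow> nat \<Rightarrow> web_vertex sgraph" where
  "web n L = rel_graph (web_verts n L) (\<lambda>(c, a, d) (c', a', d').
     c = c' \<and> d' = Suc d \<and> (d = 0 \<or> a = a') \<or> d = L \<and> d' = L \<and> link c a c' a')"

lemma verts_web [simp]: "verts (web n L) = web_verts n L"
  by (simp add: web_def)

lemma finite_web_verts: "finite (web_verts n L)"
  by (rule finite_subset[of _ "({..<n} \<times> {..<n}) \<times> {..<3} \<times> {..L}"]) (auto simp: web_verts_def)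

lemma sgraph_web: "sgraph (web n L)"
  unfolding web_def by (intro sgraph_rel_graph finite_web_verts)

lemma adj_web:
  "adj (web n L) (c, a, d) (c', a', d') \<longleftrightarrow>
     (c, a, d) \<in> web_verts n L \<and> (c', a', d') \<in> web_verts n L \<and>
     (c = c' \<and> (d' = Suc d \<and> (d = 0 \<or> a = a') \<or> d = Suc d' \<and> (d' = 0 \<or> a = a')) \<or>
      d = L \<and> d' = L \<and> link c a c' a')"
  using link_sym[of c a c' a'] link_sym[of c' a' c a] link_neq[of c a c' a']
  by (auto simp: web_def adj_rel_graph)

lemma reach_centre:
  assumes "(c, a, d) \<in> web_verts n L" "\<And>a d. (c, a, d) \<in> web_verts n L \<Longrightarrow> (c, a, d) \<in> S"
  shows "reach (web n L) S (c, a, d) (c, 0, 0)"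
  using assms(1)
proof (induction d arbitrary: a)
  case 0
  then show ?case by (simp add: web_verts_def)
next
  case (Suc d)
  \<comment> \<open>The inner neighbour; at distance 0 it is the centre, whose arm index is
    normalised to 0.\<close>
  let ?a = "if d = 0 then 0 else a"
  have v: "(c, ?a, d) \<in> web_verts n L" using Suc.prems by (auto simp: web_verts_def)
  then have "adj (web n L) (c, a, Suc d) (c, ?a, d)" using Suc.prems by (auto simp: adj_web)
  then have "(c, a, Suc d) \<in> S \<and> (c, ?a, d) \<in> S \<and> adj (web n L) (c, a, Suc d) (c, ?a, d)"
    using assms(2)[OF v] assms(2)[OF Suc.prems] by blast
  then show ?case using Suc.IH[OF v] by (rule converse_rtranclp_into_rtranclp)
qed

section \<open>Rows as branch sets, and connectedness of the web\<close>

definition web_row :: "nat \<Rightarrow> nat \<Rightarrow> nat \<Rightarrow> web_vertex set" where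
  "web_row n L i = {x \<in> web_verts n L. fst (fst x) = i}"

lemma reach_row_start:
  assumes "i < n" "j < n" "0 < L"
  shows "reach (web n L) (web_row n L i) ((i, j), 0, 0) ((i, 0), 0, 0)"
  using assms(2)
proof (induction j)
  case (Suc j)
  let ?R = "reach (web n L) (web_row n L i)"
  have row: "((i, k), a, d) \<in> web_row n L i" if "((i, k), a, d) \<in> web_verts n L" for k a d
    using that by (simp add: web_row_def)
  have in1: "((i, Suc j), 0, L) \<in> web_verts n L" and in2: "((i, j), 1, L) \<in> web_verts n L"
    using assms Suc.prems by (auto simp: web_verts_def)
  have "?R ((i, Suc j), 0, L) ((i, Suc j), 0, 0)" using in1 row by (rule reach_centre)
  then have "?R ((i, Suc j), 0, 0) ((i, Suc j), 0, L)" by (rule reach_sym)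
  also have "?R ((i, Suc j), 0, L) ((i, j), 1, L)"
    using in1 in2 row[OF in1] row[OF in2] by (intro r_into_rtranclp) (simp add: adj_web link_def)
  also have "?R ((i, j), 1, L) ((i, j), 0, 0)" using in2 row by (rule reach_centre)
  also have "?R ((i, j), 0, 0) ((i, 0), 0, 0)" using Suc by simp
  finally show ?case .
qed simp

lemma reach_in_row:
  assumes "x \<in> web_row n L i" "0 < L"
  shows "reach (web n L) (web_row n L i) x ((i, 0), 0, 0)"
proof -
  obtain j a d where x: "x = ((i, j), a, d)" "((i, j), a, d) \<in> web_verts n L"
    using assms(1) by (cases x) (auto simp: web_row_def)
  have "reach (web n L) (web_row n L i) ((i, j), a, d) ((i, j), 0, 0)"
    using x(2) by (rule reach_centre) (simp add: web_row_def)
  also have "reach (web n L) (web_row n L i) ((i, j), 0, 0) ((i, 0), 0, 0)"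
    using x(2) assms(2) by (intro reach_row_start) (auto simp: web_verts_def)
  finally show ?thesis using x(1) by simp
qed

lemma rows_adjacent:
  assumes "i < n" "j < n" "i \<noteq> j" "0 < L"
  shows "((i, j), 2, L) \<in> web_row n L i" "((j, i), 2, L) \<in> web_row n L j"
    "adj (web n L) ((i, j), 2, L) ((j, i), 2, L)"
  using assms by (auto simp: web_row_def web_verts_def adj_web link_def)

lemma web_clique_minor:
  assumes "0 < L"
  shows "clique_minor (web n L) n"
  unfolding clique_minor_def
proof (intro exI[of _ "web_row n L"] conjI allI impI)
  fix i assume i: "i < n"
  show "web_row n L i \<subseteq> verts (web n L)" by (auto simp: web_row_def)
  have "((i, 0), 0, 0) \<in> web_row n L i" using i by (auto simp: web_row_def web_verts_def)
  then show "web_row n L i \<noteq> {}" by blast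
  show "connected_set (web n L) (web_row n L i)"
    by (rule connected_setI) (rule reach_in_row[OF _ assms])
  fix j assume j: "j < n" "i \<noteq> j"
  show "\<exists>u\<in>web_row n L i. \<exists>v\<in>web_row n L j. adj (web n L) u v"
    using rows_adjacent[OF i j assms] by (intro bexI)
  show "web_row n L i \<inter> web_row n L j = {}" using j by (auto simp: web_row_def)
qed

lemma reach_web:
  assumes "x \<in> web_verts n L" "0 < L"
  shows "reach (web n L) (web_verts n L) x ((0, 0), 0, 0)"
proof -
  let ?R = "reach (web n L) (web_verts n L)"
  have row: "?R y ((i, 0), 0, 0)" if "y \<in> web_row n L i" for y i
    using reach_in_row[OF that assms(2)] by (rule reach_mono) (auto simp: web_row_def)
  define i where "i = fst (fst x)"
  have x: "?R x ((i, 0), 0, 0)" using assms(1) by (intro row) (simp add: web_row_def i_def)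
  show ?thesis
  proof (cases "i = 0")
    case False
    have n: "i < n" "0 < n" using assms(1) by (auto simp: i_def web_verts_def)
    \<comment> \<open>Any other row reaches row 0 through the link between the stars
      \<open>(i, 0)\<close> and \<open>(0, i)\<close>.\<close>
    note adj = rows_adjacent[OF n False assms(2)]
    note x
    also have "?R ((i, 0), 0, 0) ((i, 0), 2, L)" using row[OF adj(1)] by (rule reach_sym)
    also have "?R ((i, 0), 2, L) ((0, i), 2, L)"
      using adj by (intro r_into_rtranclp) (auto simp: web_row_def)
    also have "?R ((0, i), 2, L) ((0, 0), 0, 0)" using adj(2) by (rule row)
    finally show ?thesis .
  qed (use x in simp)
qed

lemma connected_web:
  assumes "0 < n" "0 < L"
  shows "connected (web n L)"
proof -
  have "((0, 0), 0, 0) \<in> web_verts n L" using assms by (simp add: web_verts_def)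
  moreover have "connected_set (web n L) (web_verts n L)"
    by (rule connected_setI) (rule reach_web[OF _ assms(2)])
  ultimately show ?thesis by (auto simp: connected_def)
qed

section \<open>Sets of at most \<open>L\<close> vertices in a web\<close>

lemma card_arm:
  assumes "finite S" "(\<lambda>d. (c, a, d)) ` {1..L} \<subseteq> S" "x \<in> S" "\<And>d. 1 \<le> d \<Longrightarrow> x \<noteq> (c, a, d)"
  shows "L < card S"
proof -
  have "card ((\<lambda>d. (c, a, d)) ` {1..L}) = L" by (subst card_image) (auto simp: inj_on_def)
  moreover have "x \<notin> (\<lambda>d. (c, a, d)) ` {1..L}"
  proof
    assume "x \<in> (\<lambda>d. (c, a, d)) ` {1..L}"
    then obtain d where "1 \<le> d" "x = (c, a, d)" by auto
    then show False using assms(4)[of d] by simp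
  qed
  \<comment> \<open>One element off the arm already exceeds \<open>L\<close>, so a set of at most
    \<open>L\<close> vertices never holds a full arm together with anything else.\<close>
  ultimately have "card (insert x ((\<lambda>d. (c, a, d)) ` {1..L})) = Suc L" by simp
  moreover have "card (insert x ((\<lambda>d. (c, a, d)) ` {1..L})) \<le> card S"
    using assms(1,2,3) by (intro card_mono) auto
  ultimately show ?thesis by simp
qed

text \<open>A vertex inside an arm has at most two neighbours, so if it belongs to \<open>S\<close>
  then both do. Spreading along the arm gives the whole arm and the centre, which is too much. Hence
  \<open>S\<close> consists of centres, and these are pairwise nonadjacent. The exempted centre is
  the one where the web will be attached to the tree and may have a neighbour outside.\<close>

lemma web_no_small_dense_set:
  assumes L: "0 < L" and S: "S \<subseteq> web_verts n L" "card S \<le> L"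
    and dense: "\<And>x. x \<in> S \<Longrightarrow> x \<noteq> ((0, 0), 0, 0) \<Longrightarrow> 2 \<le> card {y \<in> S. adj (web n L) x y}"
  shows "S \<subseteq> {((0, 0), 0, 0)}"
proof -
  have fin: "finite S" using S(1) finite_web_verts by (rule finite_subset)
  have both: "p \<in> S \<and> q \<in> S"
    if "x \<in> S" "x \<noteq> ((0, 0), 0, 0)" and sub: "\<And>y. adj (web n L) x y \<Longrightarrow> y = p \<or> y = q" for x p q
  proof -
    have "card {y \<in> S. adj (web n L) x y} \<le> card ({p, q} \<inter> S)"
      using sub by (intro card_mono) auto
    then have "2 \<le> card ({p, q} \<inter> S)" using dense[OF that(1,2)] by simp
    then show ?thesis by (cases "p \<in> S"; cases "q \<in> S") (auto simp: Int_insert_left)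
  qed
  have down: "(c, if d = 0 then 0 else a, d) \<in> S" and up: "Suc d < L \<Longrightarrow> (c, a, Suc (Suc d)) \<in> S"
    if x: "(c, a, Suc d) \<in> S" for c a d
  proof -
    \<comment> \<open>The arm linked to \<open>(c, a)\<close>, or an arbitrary pair if there is
      none; either way the neighbours are among two candidates.\<close>
    obtain c' a' where link: "\<And>c2 a2. link c a c2 a2 \<Longrightarrow> c2 = c' \<and> a2 = a'"
      by (metis link_unique)
    let ?q = "if Suc d < L then (c, a, Suc (Suc d)) else (c', a', L)"
    have "(c, if d = 0 then 0 else a, d) \<in> S \<and> ?q \<in> S"
    proof (rule both[OF x])
      fix y assume "adj (web n L) (c, a, Suc d) y"
      then show "y = (c, if d = 0 then 0 else a, d) \<or> y = ?q"
        using link by (cases y) (auto simp: adj_web web_verts_def)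
    qed simp
    then show "(c, if d = 0 then 0 else a, d) \<in> S" "Suc d < L \<Longrightarrow> (c, a, Suc (Suc d)) \<in> S"
      by auto
  qed
  have centre: "d = 0" if x: "(c, a, d) \<in> S" for c a d
  proof (rule ccontr)
    assume "d \<noteq> 0"
    have "d \<le> L" using x S(1) by (auto simp: web_verts_def)
    have low: "(c, a, d') \<in> S" if "1 \<le> d'" "d' \<le> d" for d'
      using that(2)
    proof (induction rule: inc_induct)
      case (step k)
      then show ?case using down[of c a k] that(1) by (auto split: if_splits)
    qed (rule x)
    have high: "(c, a, d') \<in> S" if "d \<le> d'" "d' \<le> L" for d'
      using that
    proof (induction rule: dec_induct)
      case (step k)
      then obtain k' where "k = Suc k'" using \<open>d \<noteq> 0\<close> by (cases k) auto
      then show ?case using step up[of c a k'] by auto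
    qed (rule x)
    have "(c, a, 1) \<in> S" using low[of 1] \<open>d \<noteq> 0\<close> by simp
    then have "(c, 0, 0) \<in> S" using down[of c a 0] by simp
    moreover have "(\<lambda>d. (c, a, d)) ` {1..L} \<subseteq> S"
      using low high by (metis (no_types, lifting) atLeastAtMost_iff image_subsetI nle_le)
    ultimately have "L < card S" using fin by (intro card_arm[of S c a L "(c, 0, 0)"]) auto
    with S(2) show False by simp
  qed
  show ?thesis
  proof (rule subsetI, rule ccontr)
    fix x assume x: "x \<in> S" "x \<notin> {((0, 0), 0, 0)}"
    then have "{y \<in> S. adj (web n L) x y} \<noteq> {}"
      using dense[of x] by (intro notI) simp
    then obtain y where y: "y \<in> S" "adj (web n L) x y" by blast
    obtain c a d c' a' d' where "x = (c, a, d)" "y = (c', a', d')" by (cases x; cases y)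
    with x y centre[of c a d] centre[of c' a' d'] L show False by (auto simp: adj_web)
  qed
qed

section \<open>Small connected parts of a web embed into megastars\<close>

lemma adj_megastar_centre:
  assumes "i < 3" "0 < b"
  shows "adj (megastar 3 b) 0 (i * b + 1)"
proof -
  have "{0, i * b + 1} \<in> {{0, i * b + 1} | i. i < 3 \<and> 1 \<le> b}"
    using assms by (intro CollectI exI[of _ i]) simp
  then show ?thesis by (simp add: adj_def megastar_def)
qed

lemma adj_megastar_arm:
  assumes "i < 3" "1 \<le> j" "j < b"
  shows "adj (megastar 3 b) (i * b + j) (Suc (i * b + j))"
proof -
  have "{i * b + j, i * b + j + 1} \<in> {{i * b + j, i * b + j + 1} | i j. i < 3 \<and> 1 \<le> j \<and> j < b}"
    using assms by blast
  then show ?thesis by (simp add: adj_def megastar_def)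
qed

lemma verts_megastar: "verts (megastar 3 b) = {0} \<union> {i * b + j | i j. i < 3 \<and> 1 \<le> j \<and> j \<le> b}"
  by (simp add: megastar_def)

lemma less_three_cases: "(a::nat) < 3 \<Longrightarrow> a = 0 \<or> a = 1 \<or> a = 2"
  by auto

text \<open>The first of the two shapes of a small connected part of a web: it stays within one
  star.\<close>

lemma web_star_embeds:
  assumes L: "0 < L" and S: "S \<subseteq> web_verts n L" "\<And>x. x \<in> S \<Longrightarrow> fst x = c"
  shows "\<exists>g. inj_on g S \<and> g ` S \<subseteq> verts (megastar 3 L) \<and>
    (\<forall>x\<in>S. \<forall>y\<in>S. adj (web n L) x y \<longrightarrow> adj (megastar 3 L) (g x) (g y))"
proof (intro exI conjI ballI impI)
  \<comment> \<open>This is the numbering used by \<open>megastar\<close>; the centre, with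
    \<open>a = 0\<close> and \<open>d = 0\<close>, becomes 0.\<close>
  let ?g = "\<lambda>(c :: nat \<times> nat, a, d). a * L + d"
  have in_S: "\<exists>a d. x = (c, a, d) \<and> a < 3 \<and> d \<le> L \<and> (d = 0 \<longrightarrow> a = 0)" if "x \<in> S" for x
    using S(1) S(2)[OF that] that by (cases x) (auto simp: web_verts_def)
  show "inj_on ?g S"
  proof (rule inj_onI)
    fix x y assume x: "x \<in> S" and y: "y \<in> S" and eq: "?g x = ?g y"
    obtain a d where xe: "x = (c, a, d)" "a < 3" "d \<le> L" "d = 0 \<longrightarrow> a = 0" using in_S[OF x] by blast
    obtain a' d' where ye: "y = (c, a', d')" "a' < 3" "d' \<le> L" "d' = 0 \<longrightarrow> a' = 0" using in_S[OF y] by blast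
    have "a * L + d = a' * L + d'" using eq xe ye by simp
    then have "a = a' \<and> d = d'"
      using less_three_cases[OF xe(2)] less_three_cases[OF ye(2)] xe(3,4) ye(3,4)
      by (elim disjE) auto
    then show "x = y" using xe ye by simp
  qed
  show "?g ` S \<subseteq> verts (megastar 3 L)"
  proof
    fix z assume "z \<in> ?g ` S"
    then obtain x where x: "x \<in> S" and z: "z = ?g x" by blast
    obtain a d where xe: "x = (c, a, d)" "a < 3" "d \<le> L" "d = 0 \<longrightarrow> a = 0" using in_S[OF x] by blast
    show "z \<in> verts (megastar 3 L)"
    proof (cases "d = 0")
      case False
      then have "z = a * L + d \<and> a < 3 \<and> 1 \<le> d \<and> d \<le> L" using xe z by simp
      then show ?thesis unfolding verts_megastar by blast
    qed (use xe z in \<open>simp add: verts_megastar\<close>)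
  qed
  fix x y assume x: "x \<in> S" and y: "y \<in> S" and adj: "adj (web n L) x y"
  obtain a d where xe: "x = (c, a, d)" "a < 3" "d \<le> L" "d = 0 \<longrightarrow> a = 0" using in_S[OF x] by blast
  obtain a' d' where ye: "y = (c, a', d')" "a' < 3" "d' \<le> L" "d' = 0 \<longrightarrow> a' = 0" using in_S[OF y] by blast
  have step: "adj (megastar 3 L) (a * L + d) (a' * L + Suc d)"
    if "d = 0 \<or> a = a'" "a < 3" "a' < 3" "Suc d \<le> L" "d = 0 \<longrightarrow> a = 0" for a d a'
  proof (cases "d = 0")
    case True
    then show ?thesis using that adj_megastar_centre[of a' L] by simp
  next
    case False
    then show ?thesis using that adj_megastar_arm[of a d L] by simp
  qed
  consider "d' = Suc d" "d = 0 \<or> a = a'" | "d = Suc d'" "d' = 0 \<or> a' = a"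
    using adj link_neq[of c a c a'] by (auto simp: xe ye adj_web)
  then show "adj (megastar 3 L) (?g x) (?g y)"
  proof cases
    case 1
    then show ?thesis using step[of d a a'] xe ye by auto
  next
    case 2
    then show ?thesis using adj_sym[OF step[of d' a' a]] xe ye by auto
  qed
qed

text \<open>The second shape: two linked arms without their centres form a path on
  \<open>2 * L\<close> vertices, which fits on a single arm of length \<open>2 * L\<close>.\<close>

lemma web_path_embeds:
  assumes L: "0 < L" and link: "link c a c' a'"
    and S: "S \<subseteq> (\<lambda>d. (c, a, d)) ` {1..L} \<union> (\<lambda>d. (c', a', d)) ` {1..L}"
  shows "\<exists>g. inj_on g S \<and> g ` S \<subseteq> verts (megastar 3 (2 * L)) \<and>
    (\<forall>x\<in>S. \<forall>y\<in>S. adj (web n L) x y \<longrightarrow> adj (megastar 3 (2 * L)) (g x) (g y))"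
proof (intro exI conjI ballI impI)
  \<comment> \<open>Numbers run outwards on the first arm and inwards on the second, so the linked
    ends receive \<open>L\<close> and \<open>L + 1\<close>.\<close>
  let ?g = "\<lambda>(e :: nat \<times> nat, a :: nat, d). if e = c then d else 2 * L + 1 - d"
  have neq: "c \<noteq> c'" using link by (rule link_neq)
  show "inj_on ?g S"
  proof (rule inj_onI)
    fix x y assume xy: "x \<in> S" "y \<in> S" "?g x = ?g y"
    then show "x = y" using subsetD[OF S xy(1)] subsetD[OF S xy(2)] neq by auto
  qed
  have "?g x \<in> {1..2 * L}" if "x \<in> S" for x
    using subsetD[OF S that] neq by auto
  moreover have "j \<in> verts (megastar 3 (2 * L))" if "j \<in> {1..2 * L}" for j
  proof -
    have "j = 0 * (2 * L) + j \<and> (0::nat) < 3 \<and> 1 \<le> j \<and> j \<le> 2 * L" using that by simp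
    then show ?thesis unfolding verts_megastar by blast
  qed
  ultimately show "?g ` S \<subseteq> verts (megastar 3 (2 * L))" by blast
  fix x y assume xy: "x \<in> S" "y \<in> S" "adj (web n L) x y"
  have step: "adj (megastar 3 (2 * L)) j k" "adj (megastar 3 (2 * L)) k j"
    if "1 \<le> j" "j < 2 * L" "k = Suc j" for j k
    using adj_megastar_arm[of 0 j "2 * L"] that by (auto intro: adj_sym)
  obtain e b d where x: "x = (e, b, d)" by (cases x)
  obtain e' b' d' where y: "y = (e', b', d')" by (cases y)
  have d: "1 \<le> d" "d \<le> L" "1 \<le> d'" "d' \<le> L" "e = c \<or> e = c'" "e' = c \<or> e' = c'"
    using subsetD[OF S xy(1)] subsetD[OF S xy(2)] x y by auto
  have "e = e' \<and> (d' = Suc d \<or> d = Suc d') \<or> e \<noteq> e' \<and> d = L \<and> d' = L"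
    using xy(3) link_neq[of e b e' b'] d by (auto simp: x y adj_web)
  then show "adj (megastar 3 (2 * L)) (?g x) (?g y)"
  proof (elim disjE conjE)
    assume "e = e'" "d' = Suc d"
    then show ?thesis using d by (auto simp: x y intro: step)
  next
    assume "e = e'" "d = Suc d'"
    then show ?thesis using d by (auto simp: x y intro: step)
  next
    assume "e \<noteq> e'" "d = L" "d' = L"
    then show ?thesis using d L by (auto simp: x y intro: step)
  qed
qed

text \<open>If \<open>S\<close> crosses a link, it contains an arm end on either side. By its size
  it misses a vertex on each of the two arms, so, being connected, it can reach neither centre and
  stays on the path between the gaps.\<close>

lemma web_small_connected_embeds:
  assumes L: "0 < L" and S: "S \<subseteq> web_verts n L" "card S \<le> L" and conn: "connected_set (web n L) S"
  shows "\<exists>b g. inj_on g S \<and> g ` S \<subseteq> verts (megastar 3 b) \<and>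
    (\<forall>x\<in>S. \<forall>y\<in>S. adj (web n L) x y \<longrightarrow> adj (megastar 3 b) (g x) (g y))"
proof (cases "\<exists>c. \<forall>x\<in>S. fst x = c")
  case True
  then obtain c where "\<And>x. x \<in> S \<Longrightarrow> fst x = c" by blast
  from web_star_embeds[OF L S(1) this] show ?thesis by blast
next
  case False
  have fin: "finite S" using S(1) finite_web_verts by (rule finite_subset)
  have "\<exists>u\<in>S. \<exists>v\<in>S. adj (web n L) u v \<and> fst u \<noteq> fst v"
  proof (rule ccontr)
    assume no: "\<not> ?thesis"
    obtain x where x: "x \<in> S" using False by blast
    have "S \<subseteq> {y. fst y = fst x}"
      by (rule connected_set_subset_closed[OF conn x]) (use no in auto)
    with False show False by blast
  qed
  then obtain u v where uv: "u \<in> S" "v \<in> S" "adj (web n L) u v" "fst u \<noteq> fst v" by blast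
  obtain c a d where ue: "u = (c, a, d)" by (cases u)
  obtain c' a' d' where ve: "v = (c', a', d')" by (cases v)
  have link: "link c a c' a'" and dL: "d = L" "d' = L" using uv(3,4) by (auto simp: ue ve adj_web)
  have neq: "c \<noteq> c'" using link by (rule link_neq)
  \<comment> \<open>The vertex \<open>v\<close> across the link is the additional element that makes
    a full arm too large.\<close>
  have "\<not> (\<lambda>d. (c, a, d)) ` {1..L} \<subseteq> S"
  proof
    assume "(\<lambda>d. (c, a, d)) ` {1..L} \<subseteq> S"
    then have "L < card S" by (rule card_arm[OF fin _ uv(2)]) (use neq in \<open>simp add: ve\<close>)
    with S(2) show False by simp
  qed
  then obtain h where h: "1 \<le> h" "h \<le> L" "(c, a, h) \<notin> S"
    by (meson atLeastAtMost_iff image_subsetI)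
  have "\<not> (\<lambda>d. (c', a', d)) ` {1..L} \<subseteq> S"
  proof
    assume "(\<lambda>d. (c', a', d)) ` {1..L} \<subseteq> S"
    then have "L < card S" by (rule card_arm[OF fin _ uv(1)]) (use neq in \<open>simp add: ue\<close>)
    with S(2) show False by simp
  qed
  then obtain h' where h': "1 \<le> h'" "h' \<le> L" "(c', a', h') \<notin> S"
    by (meson atLeastAtMost_iff image_subsetI)
  let ?Y = "(\<lambda>d. (c, a, d)) ` {h<..L} \<union> (\<lambda>d. (c', a', d)) ` {h'<..L}"
  have "h \<noteq> L" "h' \<noteq> L" using h h' uv dL ue ve by auto
  then have hL: "h < L" "h' < L" using h h' by auto
  \<comment> \<open>Stated for an arbitrary linked pair of arms, so that it applies in both
    directions of the link.\<close>
  have closed: "y \<in> (\<lambda>d. (c, a, d)) ` {h<..L} \<union> (\<lambda>d. (c', a', d)) ` {h'<..L}" if link: "link c a c' a'" and h: "1 \<le> h" "h < L" "h' < L" "(c, a, h) \<notin> S"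
    and y: "y \<in> S" and d: "h < d" "d \<le> L" and adj: "adj (web n L) (c, a, d) y" for y c a c' a' h h' d
  proof -
    obtain e b k where ye: "y = (e, b, k)" by (cases y)
    have "k \<le> L" using y S(1) by (auto simp: ye web_verts_def)
    have "e = c \<and> b = a \<and> (k = Suc d \<or> d = Suc k) \<or> k = L \<and> e = c' \<and> b = a'"
      using adj h d link_unique[OF link, of e b] by (auto simp: ye adj_web)
    then show ?thesis
    proof (elim disjE conjE)
      assume "e = c" "b = a" "k = Suc d"
      then show ?thesis using d \<open>k \<le> L\<close> by (auto simp: ye)
    next
      assume k: "e = c" "b = a" "d = Suc k"
      then have "k \<noteq> h" using h y by (auto simp: ye)
      then show ?thesis using d k by (auto simp: ye)
    next
      assume "k = L" "e = c'" "b = a'"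
      then show ?thesis using h by (auto simp: ye)
    qed
  qed
  have "S \<subseteq> ?Y"
  proof (rule connected_set_subset_closed[OF conn uv(1)])
    show "u \<in> ?Y" using hL by (auto simp: ue dL)
    fix x y assume xy: "x \<in> S" "x \<in> ?Y" "y \<in> S" "adj (web n L) x y"
    from xy(2) consider d where "x = (c, a, d)" "h < d" "d \<le> L" | d where "x = (c', a', d)" "h' < d" "d \<le> L"
      by auto
    then show "y \<in> ?Y"
    proof cases
      case 1
      then show ?thesis using closed[OF link h(1) hL h(3) xy(3), of d] xy(4) by simp
    next
      case 2
      then show ?thesis
        using closed[OF link_sym[OF link] h'(1) hL(2,1) h'(3) xy(3), of d] xy(4) by blast
    qed
  qed
  then have "S \<subseteq> (\<lambda>d. (c, a, d)) ` {1..L} \<union> (\<lambda>d. (c', a', d)) ` {1..L}" by auto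
  from web_path_embeds[OF L link this] show ?thesis by blast
qed

lemma web_contains_imp_megastar:
  assumes "connected F" "card (verts F) \<le> L" "0 < L" "contains (web n L) F"
  shows "\<exists>b. contains (megastar 3 b) F"
proof -
  obtain f where f: "inj_on f (verts F)" "\<And>u. u \<in> verts F \<Longrightarrow> f u \<in> verts (web n L)"
    "\<And>u v. u \<in> verts F \<Longrightarrow> v \<in> verts F \<Longrightarrow> adj F u v \<Longrightarrow> adj (web n L) (f u) (f v)"
    by (rule containsE[OF assms(4)]) (rule that)
  let ?S = "f ` verts F"
  have conn: "connected_set (web n L) ?S"
    using assms(1) f(3) by (intro connected_set_image[of F]) (auto simp: connected_def)
  have sub: "?S \<subseteq> web_verts n L" using f(2) by auto
  have card: "card ?S \<le> L" using f(1) assms(2) by (simp add: card_image)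
  from web_small_connected_embeds[OF assms(3) sub card conn]
  obtain b g where g: "inj_on g ?S" "g ` ?S \<subseteq> verts (megastar 3 b)"
    "\<forall>x\<in>?S. \<forall>y\<in>?S. adj (web n L) x y \<longrightarrow> adj (megastar 3 b) (g x) (g y)"
    by (elim exE conjE)
  have "contains (megastar 3 b) F"
  proof (rule containsI[of "\<lambda>u. g (f u)"])
    show "inj_on (\<lambda>u. g (f u)) (verts F)" using comp_inj_on[OF f(1) g(1)] by (simp add: comp_def)
    show "g (f u) \<in> verts (megastar 3 b)" if "u \<in> verts F" for u using that g(2) by blast
    show "adj (megastar 3 b) (g (f u)) (g (f v))" if "u \<in> verts F" "v \<in> verts F" "adj F u v" for u v
      using g(3) that f(3)[OF that] by blast
  qed
  then show ?thesis by blast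
qed

section \<open>Cliques with pendant graphs\<close>

text \<open>A list is a node of the tree, with its tail as parent; the root \<open>[]\<close> is joined to one centre
  of the web.\<close>

definition short_lists :: "nat \<Rightarrow> nat list set" where
  "short_lists m = {xs. set xs \<subseteq> {..<m} \<and> length xs \<le> m}"

text \<open>Edges between tree and web are listed only from the tree side; \<open>rel_graph\<close>
  symmetrises, which is why the last clause is \<open>False\<close>.\<close>

fun pendant_rel :: "nat \<Rightarrow> nat \<Rightarrow> nat list + web_vertex \<Rightarrow> nat list + web_vertex \<Rightarrow> bool" where
  "pendant_rel n L (Inl xs) (Inl ys) \<longleftrightarrow> (\<exists>x. ys = x # xs)"
| "pendant_rel n L (Inl xs) (Inr w) \<longleftrightarrow> xs = [] \<and> w = ((0, 0), 0, 0)"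
| "pendant_rel n L (Inr w) (Inr w') \<longleftrightarrow> adj (web n L) w w'"
| "pendant_rel n L (Inr w) (Inl xs) \<longleftrightarrow> False"

definition pendant :: "nat \<Rightarrow> nat \<Rightarrow> nat \<Rightarrow> (nat list + web_vertex) sgraph" where
  "pendant m n L = rel_graph (Inl ` short_lists m \<union> Inr ` web_verts n L) (pendant_rel n L)"

lemma verts_pendant [simp]: "verts (pendant m n L) = Inl ` short_lists m \<union> Inr ` web_verts n L"
  by (simp add: pendant_def)

lemma sgraph_pendant: "sgraph (pendant m n L)"
proof -
  have "finite (short_lists m)"
    unfolding short_lists_def by (rule finite_lists_length_le) simp
  then show ?thesis
    unfolding pendant_def using finite_web_verts by (intro sgraph_rel_graph) simp
qed

lemma adj_pendant [simp]:
  "adj (pendant m n L) (Inl xs) (Inl ys) \<longleftrightarrow>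
     xs \<in> short_lists m \<and> ys \<in> short_lists m \<and> ((\<exists>x. ys = x # xs) \<or> (\<exists>y. xs = y # ys))"
  "adj (pendant m n L) (Inl xs) (Inr w) \<longleftrightarrow>
     xs \<in> short_lists m \<and> w \<in> web_verts n L \<and> xs = [] \<and> w = ((0, 0), 0, 0)"
  "adj (pendant m n L) (Inr w) (Inl xs) \<longleftrightarrow>
     xs \<in> short_lists m \<and> w \<in> web_verts n L \<and> xs = [] \<and> w = ((0, 0), 0, 0)"
  "adj (pendant m n L) (Inr w) (Inr w') \<longleftrightarrow> adj (web n L) w w'"
  using adjD[OF sgraph_web, of n L w w'] adjD[OF sgraph_web, of n L w' w] adj_sym[of "web n L" w' w]
  by (auto simp: pendant_def adj_rel_graph)

lemma connected_pendant:
  assumes "0 < n" "0 < L"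
  shows "connected (pendant m n L)"
proof -
  let ?P = "pendant m n L"
  let ?R = "reach ?P (verts ?P)"
  have nil: "[] \<in> short_lists m" by (simp add: short_lists_def)
  have tree: "?R (Inl xs) (Inl [])" if "xs \<in> short_lists m" for xs
    using that
  proof (induction xs)
    case (Cons x xs)
    then have xs: "xs \<in> short_lists m" by (auto simp: short_lists_def)
    have "Inl (x # xs) \<in> verts ?P \<and> Inl xs \<in> verts ?P \<and> adj ?P (Inl (x # xs)) (Inl xs)"
      using xs Cons.prems by auto
    then show ?case using Cons.IH[OF xs] by (rule converse_rtranclp_into_rtranclp)
  qed simp
  have web: "?R (Inr w) (Inl [])" if w: "w \<in> web_verts n L" for w
  proof -
    let ?o = "((0, 0), 0, 0) :: web_vertex"
    have o: "?o \<in> web_verts n L" using assms by (simp add: web_verts_def)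
    have "?R (Inr w) (Inr ?o)" by (rule reach_image[OF reach_web[OF w assms(2)]]) auto
    also have "?R (Inr ?o) (Inl [])" using o nil by (intro r_into_rtranclp) auto
    finally show ?thesis .
  qed
  have "connected_set ?P (verts ?P)"
  proof (rule connected_setI)
    fix x assume "x \<in> verts ?P"
    then show "?R x (Inl [])" using tree web by (cases x) auto
  qed
  then show ?thesis using nil by (auto simp: connected_def)
qed

text \<open>The web part of \<open>S\<close> inherits the density condition except at the attaching
  centre, so at most this centre survives, and then its only possible neighbour in \<open>S\<close>
  is the root of the tree, one too few. What remains lies in a tree, where a deepest vertex has too
  few neighbours.\<close>

lemma pendant_no_small_dense_set:
  assumes L: "0 < L" and S: "S \<subseteq> verts (pendant m n L)" "card S \<le> L"
    and dense: "\<And>x. x \<in> S \<Longrightarrow> x \<noteq> Inl [] \<Longrightarrow> 2 \<le> card {y \<in> S. adj (pendant m n L) x y}"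
  shows "S \<subseteq> {Inl []}"
proof -
  let ?P = "pendant m n L" and ?o = "((0, 0), 0, 0) :: web_vertex"
  have fin: "finite S"
    using S(1) sgraph_pendant[of m n L] by (auto simp: sgraph_def intro: finite_subset)
  define W where "W = {w. Inr w \<in> S}"
  have small: False if x: "x \<in> S" "x \<noteq> Inl []" and "\<And>y. y \<in> S \<Longrightarrow> adj ?P x y \<Longrightarrow> y = z" for x z
  proof -
    have "card {y \<in> S. adj ?P x y} \<le> card {z}" using that(3) by (intro card_mono) auto
    then show False using dense[OF x] by simp
  qed
  have "W \<subseteq> {?o}"
  proof (rule web_no_small_dense_set[OF L])
    show "W \<subseteq> web_verts n L" using S(1) by (auto simp: W_def)
    have "card W \<le> card S" using fin by (intro card_inj_on_le[of Inr]) (auto simp: W_def)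
    then show "card W \<le> L" using S(2) by simp
    fix w assume w: "w \<in> W" "w \<noteq> ?o"
    have "{y \<in> S. adj ?P (Inr w) y} \<subseteq> Inr ` {w' \<in> W. adj (web n L) w w'}"
    proof
      fix y assume "y \<in> {y \<in> S. adj ?P (Inr w) y}"
      then show "y \<in> Inr ` {w' \<in> W. adj (web n L) w w'}" using w by (cases y) (auto simp: W_def)
    qed
    moreover have "finite W" using fin unfolding W_def by (intro finite_inverse_image) auto
    ultimately have "card {y \<in> S. adj ?P (Inr w) y} \<le> card {w' \<in> W. adj (web n L) w w'}"
      by (intro surj_card_le) auto
    then show "2 \<le> card {w' \<in> W. adj (web n L) w w'}" using dense[of "Inr w"] w by (simp add: W_def)
  qed
  have no_web: "Inr w \<notin> S" for w
  proof
    assume w: "Inr w \<in> S"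
    show False
    proof (rule small[OF w, of "Inl []"])
      fix y assume y: "y \<in> S" "adj ?P (Inr w) y"
      show "y = Inl []"
      proof (cases y)
        case (Inr w')
        then have "w = w'" using w y(1) \<open>W \<subseteq> {?o}\<close> by (auto simp: W_def)
        then show ?thesis using y(2) Inr adjD(3)[OF sgraph_web, of n L w w'] by simp
      qed (use y in auto)
    qed simp
  qed
  show ?thesis
  proof (rule ccontr)
    assume "\<not> S \<subseteq> {Inl []}"
    then obtain z where z: "z \<in> S" "z \<noteq> Inl []" by blast
    then obtain zs where zs: "Inl zs \<in> S" "zs \<noteq> []" using no_web by (cases z) auto
    define K where "K = {xs. Inl xs \<in> S}"
    have "finite K" using fin unfolding K_def by (intro finite_inverse_image) auto
    moreover have "zs \<in> K" using zs by (simp add: K_def)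
    ultimately have "Max (length ` K) \<in> length ` K" by (intro Max_in) auto
    \<comment> \<open>Children of a longest list are longer, so within \<open>S\<close> only its
      parent \<open>tl xs\<close> can be a neighbour.\<close>
    then obtain xs where xs: "xs \<in> K" "Max (length ` K) = length xs" by auto
    have long: "length ys \<le> length xs" if "ys \<in> K" for ys
      using that \<open>finite K\<close> xs(2) by (metis Max_ge finite_imageI imageI)
    have "xs \<noteq> []" using long[OF \<open>zs \<in> K\<close>] zs(2) by auto
    show False
    proof (rule small[of "Inl xs" "Inl (tl xs)"])
      show "Inl xs \<in> S" using xs(1) by (simp add: K_def)
      show "Inl xs \<noteq> Inl []" using \<open>xs \<noteq> []\<close> by simp
      fix y assume y: "y \<in> S" "adj ?P (Inl xs) y"
      then obtain ys where ys: "y = Inl ys" using no_web by (cases y) auto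
      have "length ys \<le> length xs" using long[of ys] y(1) ys by (simp add: K_def)
      then show "y = Inl (tl xs)" using y(2) ys by auto
    qed
  qed
qed

section \<open>Gluing a rooted graph to every vertex of a clique\<close>

definition pendant_clique :: "'a set \<Rightarrow> 'b sgraph \<Rightarrow> 'b \<Rightarrow> ('a \<times> 'b) sgraph" where
  "pendant_clique A R r = rel_graph (A \<times> verts R)
     (\<lambda>(a, x) (b, y). a = b \<and> adj R x y \<or> a \<noteq> b \<and> x = r \<and> y = r)"

lemma verts_pendant_clique [simp]: "verts (pendant_clique A R r) = A \<times> verts R"
  by (simp add: pendant_clique_def)

lemma sgraph_pendant_clique: "finite A \<Longrightarrow> sgraph R \<Longrightarrow> sgraph (pendant_clique A R r)"
  unfolding pendant_clique_def by (intro sgraph_rel_graph) (simp add: sgraph_def)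

lemma adj_pendant_clique:
  assumes "sgraph R"
  shows "adj (pendant_clique A R r) (a, x) (b, y) \<longleftrightarrow> a \<in> A \<and> b \<in> A \<and> x \<in> verts R \<and> y \<in> verts R \<and>
    (a = b \<and> adj R x y \<or> a \<noteq> b \<and> x = r \<and> y = r)"
  using adjD(3)[OF assms, of x y] adj_sym[of R]
  by (auto simp: pendant_clique_def adj_rel_graph)

lemma connected_pendant_clique:
  assumes sg: "sgraph R" and co: "connected R" and r: "r \<in> verts R" and "c \<in> A"
  shows "connected (pendant_clique A R r)"
proof -
  let ?G = "pendant_clique A R r"
  have "connected_set ?G (verts ?G)"
  proof (rule connected_setI)
    fix v assume "v \<in> verts ?G"
    then obtain a x where v: "v = (a, x)" "a \<in> A" "x \<in> verts R" by auto
    have "reach R (verts R) x r" using co v(3) r by (auto simp: connected_def connected_setD)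
    then have "reach ?G (verts ?G) (a, x) (a, r)"
      by (rule reach_image) (use v(2) in \<open>auto simp: adj_pendant_clique[OF sg]\<close>)
    also have "reach ?G (verts ?G) (a, r) (c, r)"
    proof (cases "a = c")
      case False
      then show ?thesis
        using v(2) assms(3,4) by (intro r_into_rtranclp) (auto simp: adj_pendant_clique[OF sg])
    qed simp
    finally show "reach ?G (verts ?G) v (c, r)" using v(1) by simp
  qed
  then show ?thesis using assms(3,4) by (auto simp: connected_def)
qed

text \<open>One round of the game on bare sets: a repeated element is answered by its partner, a new
  one by an element of \<open>B\<close> outside the image of \<open>D\<close>, which is too small to
  exhaust \<open>B\<close>.\<close>

lemma match_extend:
  assumes "finite D" "card D < card B" "g ` D \<subseteq> B" "\<And>x y. x \<in> D \<Longrightarrow> y \<in> D \<Longrightarrow> f x = f y \<longleftrightarrow> g x = g y"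
  shows "\<exists>b\<in>B. \<forall>y\<in>D. f y = a \<longleftrightarrow> g y = b"
proof (cases "\<exists>x\<in>D. f x = a")
  case True
  then obtain x where x: "x \<in> D" "f x = a" by blast
  have "f y = a \<longleftrightarrow> g y = g x" if "y \<in> D" for y using assms(4)[OF that x(1)] x(2) by simp
  then show ?thesis using x(1) assms(3) by (intro bexI[of _ "g x"]) auto
next
  case False
  have "card (g ` D) < card B" using card_image_le[OF assms(1), of g] assms(2) by simp
  then have "\<not> B \<subseteq> g ` D" using card_mono[of "g ` D" B] assms(1) by auto
  then obtain b where "b \<in> B" "b \<notin> g ` D" by blast
  then show ?thesis using False by (intro bexI[of _ b]) auto
qed

text \<open>Adjacency and equality depend only on the positions within the copies and on whether the
  copies coincide. So Duplicator repeats the second coordinate and plays the first one as on a bare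
  set.\<close>

lemma models_pendant_clique:
  fixes A :: "'a set" and R :: "'b sgraph" and B :: "'c set"
  assumes sg: "sgraph R" and phi: "sentence \<phi>" "var_width \<phi> \<le> card A" "var_width \<phi> \<le> card B"
  shows "models (pendant_clique A R r) \<phi> \<longleftrightarrow> models (pendant_clique B R r) \<phi>"
  unfolding models_def
proof (rule sat_back_and_forth[where X = "vars \<phi>" and inv = "\<lambda>D \<alpha> \<beta>.
    (\<forall>x\<in>D. \<alpha> x \<in> A \<times> verts R \<and> \<beta> x \<in> B \<times> verts R \<and> snd (\<alpha> x) = snd (\<beta> x)) \<and>
    (\<forall>x\<in>D. \<forall>y\<in>D. fst (\<alpha> x) = fst (\<alpha> y) \<longleftrightarrow> fst (\<beta> x) = fst (\<beta> y))"])
  fix D :: "nat set" and \<alpha> :: "nat \<Rightarrow> 'a \<times> 'b" and \<beta> :: "nat \<Rightarrow> 'c \<times> 'b" and x y :: nat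
  assume inv: "(\<forall>x\<in>D. \<alpha> x \<in> A \<times> verts R \<and> \<beta> x \<in> B \<times> verts R \<and> snd (\<alpha> x) = snd (\<beta> x)) \<and>
    (\<forall>x\<in>D. \<forall>y\<in>D. fst (\<alpha> x) = fst (\<alpha> y) \<longleftrightarrow> fst (\<beta> x) = fst (\<beta> y))"
  show "(\<forall>x\<in>D'. \<alpha> x \<in> A \<times> verts R \<and> \<beta> x \<in> B \<times> verts R \<and> snd (\<alpha> x) = snd (\<beta> x)) \<and>
    (\<forall>x\<in>D'. \<forall>y\<in>D'. fst (\<alpha> x) = fst (\<alpha> y) \<longleftrightarrow> fst (\<beta> x) = fst (\<beta> y))" if "D' \<subseteq> D" for D'
    using inv that by (meson subsetD)
  {
    assume xy: "x \<in> D" "y \<in> D"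
    have "\<alpha> x \<in> A \<times> verts R" "\<beta> x \<in> B \<times> verts R" "snd (\<alpha> x) = snd (\<beta> x)"
      "\<alpha> y \<in> A \<times> verts R" "\<beta> y \<in> B \<times> verts R" "snd (\<alpha> y) = snd (\<beta> y)"
      "fst (\<alpha> x) = fst (\<alpha> y) \<longleftrightarrow> fst (\<beta> x) = fst (\<beta> y)"
      using inv xy by blast+
    then show "adj (pendant_clique A R r) (\<alpha> x) (\<alpha> y) \<longleftrightarrow> adj (pendant_clique B R r) (\<beta> x) (\<beta> y)"
      and "\<alpha> x = \<alpha> y \<longleftrightarrow> \<beta> x = \<beta> y"
      by (cases "\<alpha> x"; cases "\<alpha> y"; cases "\<beta> x"; cases "\<beta> y"; auto simp: adj_pendant_clique[OF sg])+
  }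
  assume D: "insert x D \<subseteq> vars \<phi>" "x \<notin> D"
  have fin: "finite D" using D finite_vars[of \<phi>] by (auto intro: finite_subset)
  have "card (insert x D) \<le> var_width \<phi>"
    unfolding var_width_def using D(1) finite_vars by (rule card_mono[rotated])
  \<comment> \<open>As \<open>x\<close> is not in \<open>D\<close>, fewer than
    \<open>var_width \<phi>\<close> pebbles lie on the board before a move; therefore clique sizes
    equal to the width are enough.\<close>
  then have small: "card D < card A" "card D < card B" using phi D(2) fin by auto
  show "\<exists>w\<in>verts (pendant_clique B R r).
      (\<forall>z\<in>insert x D. (\<alpha>(x := v)) z \<in> A \<times> verts R \<and> (\<beta>(x := w)) z \<in> B \<times> verts R \<and>
        snd ((\<alpha>(x := v)) z) = snd ((\<beta>(x := w)) z)) \<and>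
      (\<forall>z\<in>insert x D. \<forall>y\<in>insert x D. fst ((\<alpha>(x := v)) z) = fst ((\<alpha>(x := v)) y) \<longleftrightarrow>
        fst ((\<beta>(x := w)) z) = fst ((\<beta>(x := w)) y))"
    if v: "v \<in> verts (pendant_clique A R r)" for v
  proof -
    have "\<exists>b\<in>B. \<forall>y\<in>D. fst (\<alpha> y) = fst v \<longleftrightarrow> fst (\<beta> y) = b"
      by (rule match_extend[OF fin small(2)]) (use inv in auto)
    then obtain b where b: "b \<in> B" "\<forall>y\<in>D. fst (\<alpha> y) = fst v \<longleftrightarrow> fst (\<beta> y) = b" by blast
    have b': "\<forall>y\<in>D. fst v = fst (\<alpha> y) \<longleftrightarrow> b = fst (\<beta> y)" using b(2) by metis
    show ?thesis
      by (rule bexI[of _ "(b, snd v)"]) (use v b b' inv D(2) in auto)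
  qed
  show "\<exists>v\<in>verts (pendant_clique A R r).
      (\<forall>z\<in>insert x D. (\<alpha>(x := v)) z \<in> A \<times> verts R \<and> (\<beta>(x := w)) z \<in> B \<times> verts R \<and>
        snd ((\<alpha>(x := v)) z) = snd ((\<beta>(x := w)) z)) \<and>
      (\<forall>z\<in>insert x D. \<forall>y\<in>insert x D. fst ((\<alpha>(x := v)) z) = fst ((\<alpha>(x := v)) y) \<longleftrightarrow>
        fst ((\<beta>(x := w)) z) = fst ((\<beta>(x := w)) y))"
    if w: "w \<in> verts (pendant_clique B R r)" for w
  proof -
    have "\<exists>b\<in>A. \<forall>y\<in>D. fst (\<beta> y) = fst w \<longleftrightarrow> fst (\<alpha> y) = b"
      by (rule match_extend[OF fin small(1)]) (use inv in auto)
    then obtain b where b: "b \<in> A" "\<forall>y\<in>D. fst (\<beta> y) = fst w \<longleftrightarrow> fst (\<alpha> y) = b" by blast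
    have b': "\<forall>y\<in>D. fst w = fst (\<beta> y) \<longleftrightarrow> b = fst (\<alpha> y)" using b(2) by metis
    show ?thesis
      by (rule bexI[of _ "(b, snd w)"]) (use w b b' inv D(2) in auto)
  qed
qed (use phi in \<open>auto simp: sentence_def\<close>)

text \<open>All neighbours of a vertex other than a root lie in its own copy. Each slice of an image
  of \<open>F\<close> thus satisfies the density condition away from \<open>r\<close> and shrinks to
  the root by the hypothesis on \<open>R\<close>. Then \<open>F\<close> would inject into the
  \<open>card A\<close> roots.\<close>

lemma pendant_clique_not_contains:
  assumes sg: "sgraph R" and A: "finite A" "card A < card (verts F)"
    and F: "sgraph F" "\<And>v. v \<in> verts F \<Longrightarrow> 2 \<le> degree F v"
    and R: "\<And>S. S \<subseteq> verts R \<Longrightarrow> card S \<le> card (verts F) \<Longrightarrow>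
      (\<And>x. x \<in> S \<Longrightarrow> x \<noteq> r \<Longrightarrow> 2 \<le> card {y \<in> S. adj R x y}) \<Longrightarrow> S \<subseteq> {r}"
  shows "\<not> contains (pendant_clique A R r) F"
proof
  let ?G = "pendant_clique A R r"
  assume "contains ?G F"
  then obtain f where f: "inj_on f (verts F)" "\<And>u. u \<in> verts F \<Longrightarrow> f u \<in> verts ?G"
    "\<And>u v. u \<in> verts F \<Longrightarrow> v \<in> verts F \<Longrightarrow> adj F u v \<Longrightarrow> adj ?G (f u) (f v)"
    by (rule containsE) (rule that)
  let ?S = "f ` verts F"
  have finF: "finite (verts F)" using F(1) by (simp add: sgraph_def)
  have "{x. (a, x) \<in> ?S} \<subseteq> {r}" for a
  proof (rule R)
    let ?Sa = "{x. (a, x) \<in> ?S}"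
    show "?Sa \<subseteq> verts R"
    proof
      fix x assume "x \<in> ?Sa"
      then obtain u where "u \<in> verts F" "f u = (a, x)" by auto
      then show "x \<in> verts R" using f(2)[of u] by simp
    qed
    have "card ?Sa \<le> card ?S"
      using finF by (intro card_inj_on_le[of "Pair a"]) (auto simp: inj_on_def)
    also have "\<dots> \<le> card (verts F)" using finF by (rule card_image_le)
    finally show "card ?Sa \<le> card (verts F)" .
    fix x assume x: "x \<in> ?Sa" "x \<noteq> r"
    then obtain u where u: "u \<in> verts F" "f u = (a, x)" by auto
    let ?N = "{w \<in> verts F. adj F u w}" and ?M = "{y \<in> ?Sa. adj R x y}"
    have "f ` ?N \<subseteq> Pair a ` ?M"
    proof
      fix y assume "y \<in> f ` ?N"
      then obtain w where w: "w \<in> verts F" "adj F u w" "y = f w" by auto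
      obtain b z where fw: "f w = (b, z)" by (cases "f w")
      have "adj ?G (a, x) (b, z)" using f(3)[OF u(1) w(1,2)] u(2) fw by simp
      then have "b = a" "adj R x z" using x(2) by (auto simp: adj_pendant_clique[OF sg])
      moreover have "(b, z) \<in> ?S" using w(1) fw by (metis imageI)
      ultimately show "y \<in> Pair a ` ?M" using w(3) fw by auto
    qed
    moreover have "finite ?M"
      by (rule finite_subset[of _ "verts R"]) (use sg adjD(2)[OF sg] in \<open>auto simp: sgraph_def\<close>)
    ultimately have "card (f ` ?N) \<le> card ?M" by (intro surj_card_le)
    moreover have "card (f ` ?N) = degree F u"
      unfolding degree_def by (rule card_image[OF inj_on_subset[OF f(1)]]) auto
    ultimately show "2 \<le> card ?M" using F(2)[OF u(1)] by simp
  qed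
  then have root: "x = r" if "(a, x) \<in> ?S" for a x using that by blast
  have "?S \<subseteq> A \<times> {r}"
  proof
    fix p assume p: "p \<in> ?S"
    obtain a x where ax: "p = (a, x)" by (cases p)
    have "p \<in> A \<times> verts R" using p f(2) by auto
    then show "p \<in> A \<times> {r}" using root[of a x] p ax by simp
  qed
  then have "card ?S \<le> card (A \<times> {r})" using A(1) by (intro card_mono) auto
  then show False using A(2) f(1) by (simp add: card_image card_cartesian_product)
qed

text \<open>The core occupies the roots. Peeled vertices return in reverse order, each as a new
  child of the image of its only neighbour.\<close>

lemma pendant_clique_contains:
  assumes "peel\<^sup>*\<^sup>* F F0" "sgraph F" "card (verts F) \<le> m" "verts F0 \<noteq> {}"
  shows "contains (pendant_clique {..<card (verts F0)} (pendant m n L) (Inl [])) F"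
proof -
  let ?A = "{..<card (verts F0)}" and ?R = "pendant m n L"
  let ?G = "pendant_clique ?A ?R (Inl [])"
  have nil: "[] \<in> short_lists m" by (simp add: short_lists_def)
  note adjG = adj_pendant_clique[OF sgraph_pendant]
  \<comment> \<open>The image stays in the trees, and its depth is bounded by the number of vertices
    placed, so that one more child still lies in \<open>short_lists m\<close>.\<close>
  have "\<exists>f. inj_on f (verts F) \<and>
      (\<forall>u\<in>verts F. \<exists>a\<in>?A. \<exists>xs\<in>short_lists m. f u = (a, Inl xs) \<and> length xs \<le> card (verts F)) \<and>
      (\<forall>u\<in>verts F. \<forall>v\<in>verts F. adj F u v \<longrightarrow> adj ?G (f u) (f v))"
    using assms(1-3)
  proof (induction rule: converse_rtranclp_induct)
    case base
    have "finite (verts F0)" using base by (simp add: sgraph_def)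
    then obtain h where h: "bij_betw h (verts F0) ?A"
      using finite_same_card_bij[of "verts F0" ?A] by auto
    have hA: "h u \<in> ?A" if "u \<in> verts F0" for u using h that by (auto simp: bij_betw_def)
    have inj: "h u \<noteq> h v" if "u \<in> verts F0" "v \<in> verts F0" "u \<noteq> v" for u v
      using h that by (auto simp: bij_betw_def inj_on_eq_iff)
    show ?case
    proof (intro exI[of _ "\<lambda>u. (h u, Inl [])"] conjI ballI impI)
      show "inj_on (\<lambda>u. (h u, Inl [])) (verts F0)" using h by (auto simp: bij_betw_def inj_on_def)
      show "\<exists>a\<in>?A. \<exists>xs\<in>short_lists m. (h u, Inl []) = (a, Inl xs) \<and> length xs \<le> card (verts F0)"
        if "u \<in> verts F0" for u using hA[OF that] nil by force
      show "adj ?G (h u, Inl []) (h v, Inl [])" if "u \<in> verts F0" "v \<in> verts F0" "adj F0 u v" for u v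
        using hA[OF that(1)] hA[OF that(2)] inj[OF that(1,2) adjD(3)[OF base(1) that(3)]] nil
        by (simp add: adjG)
    qed
  next
    case (step H H')
    obtain v where v: "v \<in> verts H" "degree H v \<le> 1" and H': "H' = delete_vertex H v"
      using step.hyps(1) by (auto simp: peel_def)
    have finH: "finite (verts H)" using step.prems(1) by (simp add: sgraph_def)
    have cH: "card (verts H) = Suc (card (verts H'))"
      using card.remove[OF finH v(1)] by (simp add: H')
    obtain f where f: "inj_on f (verts H')"
      "\<forall>u\<in>verts H'. \<exists>a\<in>?A. \<exists>xs\<in>short_lists m. f u = (a, Inl xs) \<and> length xs \<le> card (verts H')"
      "\<forall>u\<in>verts H'. \<forall>v\<in>verts H'. adj H' u v \<longrightarrow> adj ?G (f u) (f v)"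
      using step.IH sgraph_peel[OF step.hyps(1) step.prems(1)] step.prems(2) cH by auto
    have nbr: "u = w" if "adj H v u" "adj H v w" for u w
    proof -
      have "finite {u \<in> verts H. adj H v u}" using finH by simp
      then show ?thesis
        using v(2) card_le_Suc0_iff_eq[of "{u \<in> verts H. adj H v u}"] that
          adjD(2)[OF step.prems(1)] by (auto simp: degree_def)
    qed
    obtain a xs where a: "a \<in> ?A" "xs \<in> short_lists m" "length xs \<le> card (verts H')"
      and fu: "\<And>u. adj H v u \<Longrightarrow> f u = (a, Inl xs)"
    proof (cases "\<exists>u. adj H v u")
      case True
      then obtain u where u: "adj H v u" by blast
      then have "u \<in> verts H'" using adjD[OF step.prems(1) u] by (simp add: H')
      then obtain a xs where axs: "a \<in> ?A" "xs \<in> short_lists m" "f u = (a, Inl xs)" "length xs \<le> card (verts H')"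
        using f(2) by blast
      show thesis by (rule that[OF axs(1,2,4)]) (use nbr[OF u] axs(3) in blast)
    next
      case False
      \<comment> \<open>A vertex that is isolated when peeled goes below the root of copy 0, which
        exists because the core is nonempty.\<close>
      have "finite (verts F0)"
        using step.hyps(2) sgraph_peel[OF step.hyps(1) step.prems(1)]
        by (induction rule: rtranclp_induct) (auto simp: sgraph_def peel_def)
      then have "0 \<in> ?A" using assms(4) by (simp add: card_gt_0_iff)
      then show thesis by (rule that[of 0 "[]"]) (use False nil in auto)
    qed
    \<comment> \<open>Fewer than \<open>m\<close> vertices have been placed, so one of the
      \<open>m\<close> children is free.\<close>
    have "\<exists>x<m. (a, Inl (x # xs)) \<notin> f ` verts H'"
    proof (rule ccontr)
      assume "\<not> ?thesis"
      then have "(\<lambda>x. (a, Inl (x # xs))) ` {..<m} \<subseteq> f ` verts H'" by auto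
      then have "card {..<m} \<le> card (f ` verts H')"
        using finH by (intro card_inj_on_le) (auto simp: inj_on_def H')
      also have "\<dots> \<le> card (verts H')" using finH by (intro card_image_le) (simp add: H')
      finally show False using step.prems(2) cH by simp
    qed
    then obtain x where x: "x < m" "(a, Inl (x # xs)) \<notin> f ` verts H'" by blast
    let ?f = "f(v := (a, Inl (x # xs)))"
    have len: "length (x # xs) \<le> card (verts H)" using a(3) cH by simp
    then have xxs: "x # xs \<in> short_lists m" using x(1) a(2) step.prems(2) by (auto simp: short_lists_def)
    have VH: "verts H = insert v (verts H')" "v \<notin> verts H'" using v(1) by (auto simp: H')
    have pend: "adj ?G (a, Inl (x # xs)) (a, Inl xs)" using a(1,2) xxs by (auto simp: adjG)
    show ?case
    proof (intro exI[of _ ?f] conjI ballI impI)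
      have "inj_on ?f (verts H')" using f(1) VH(2) by (auto simp: inj_on_def)
      moreover have "?f v \<notin> ?f ` verts H'" using x(2) VH(2) by auto
      ultimately show "inj_on ?f (verts H)" using VH by simp
      fix u assume u: "u \<in> verts H"
      show "\<exists>a\<in>?A. \<exists>xs\<in>short_lists m. ?f u = (a, Inl xs) \<and> length xs \<le> card (verts H)"
      proof (cases "u = v")
        case True
        then show ?thesis using a(1) xxs len by auto
      next
        case False
        then have "u \<in> verts H'" using u VH by simp
        then show ?thesis using f(2) False cH by (metis fun_upd_other le_SucI)
      qed
      fix w assume w: "w \<in> verts H" and uw: "adj H u w"
      have "u \<noteq> w" using adjD(3)[OF step.prems(1) uw] .
      consider "u = v" | "w = v" | "u \<noteq> v" "w \<noteq> v" by blast
      then show "adj ?G (?f u) (?f w)"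
      proof cases
        case 1
        then show ?thesis using fu[of w] uw \<open>u \<noteq> w\<close> pend by simp
      next
        case 2
        then show ?thesis using fu[of u] adj_sym[OF uw] \<open>u \<noteq> w\<close> adj_sym[OF pend] by simp
      next
        case 3
        then have "u \<in> verts H'" "w \<in> verts H'" "adj H' u w"
          using u w uw by (simp_all add: H' adj_delete_vertex)
        then have "adj ?G (f u) (f w)" using f(3) by blast
        then show ?thesis using 3 by simp
      qed
    qed
  qed
  then obtain f where f: "inj_on f (verts F)"
    "\<forall>u\<in>verts F. \<exists>a\<in>?A. \<exists>xs\<in>short_lists m. f u = (a, Inl xs) \<and> length xs \<le> card (verts F)"
    "\<forall>u\<in>verts F. \<forall>v\<in>verts F. adj F u v \<longrightarrow> adj ?G (f u) (f v)" by blast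
  show ?thesis
  proof (rule containsI[OF f(1)])
    show "f u \<in> verts ?G" if "u \<in> verts F" for u using f(2) that by fastforce
    show "adj ?G (f u) (f v)" if "u \<in> verts F" "v \<in> verts F" "adj F u v" for u v
      using f(3) that by blast
  qed
qed

lemma pendant_clique_contains_web:
  assumes "c \<in> A"
  shows "contains (pendant_clique A (pendant m n L) r) (web n L)"
  by (rule containsI[of "\<lambda>x. (c, Inr x)"])
    (use assms in \<open>auto simp: inj_on_def adj_pendant_clique[OF sgraph_pendant]\<close>)

section \<open>The lower bounds\<close>

lemma treewidth_ge_web:
  assumes "sgraph G" "contains G (web (Suc k) L)" "0 < L"
  shows "k \<le> treewidth G"
  using clique_minor_le_treewidth[OF assms(1) clique_minor_mono[OF assms(2) web_clique_minor[OF assms(3)]]]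
  by simp

lemma contains_peel:
  assumes "peel\<^sup>*\<^sup>* F F0"
  shows "contains F F0"
proof -
  have "verts F0 \<subseteq> verts F \<and> (\<forall>u v. adj F0 u v \<longrightarrow> adj F u v)"
    using assms by (induction rule: rtranclp_induct) (auto simp: peel_def adj_delete_vertex)
  then show ?thesis by (intro containsI[of "\<lambda>x. x"]) auto
qed

theorem W_tw_ge_core:
  fixes F :: "'a sgraph"
  assumes sg: "sgraph F" and core: "is_core F F0"
  shows "card (verts F0) \<le> W_tw F"
proof (cases "verts F0 = {}")
  case False
  have peel: "peel\<^sup>*\<^sup>* F F0" and deg: "\<And>v. v \<in> verts F0 \<Longrightarrow> 2 \<le> degree F0 v"
    using core by (auto simp: is_core_def)
  have sg0: "sgraph F0"
    using peel sg by (induction rule: rtranclp_induct) (auto intro: sgraph_peel)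
  have fin0: "finite (verts F0)" using sg0 by (simp add: sgraph_def)
  obtain v where v: "v \<in> verts F0" using False by blast
  \<comment> \<open>Minimum degree two forces at least two core vertices, so the clique on
    \<open>l - 1\<close> vertices is nonempty.\<close>
  have "2 \<le> card {u \<in> verts F0. adj F0 v u}" using deg[OF v] by (simp add: degree_def)
  also have "\<dots> \<le> card (verts F0)" using fin0 by (intro card_mono) auto
  finally have two: "2 \<le> card (verts F0)" .
  obtain i where i: "inj_on i (verts F0)" "\<And>u. u \<in> verts F0 \<Longrightarrow> i u \<in> verts F"
    by (rule containsE[OF contains_peel[OF peel]]) (rule that)
  have le: "card (verts F0) \<le> card (verts F)"
    using i sg by (intro card_inj_on_le[of i]) (auto simp: sgraph_def)
  show ?thesis
  proof (rule W_tw_geI[OF sg])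
    fix \<phi> :: fo and k :: nat assume phi: "sentence \<phi>" "var_width \<phi> < card (verts F0)"
    let ?m = "card (verts F)"
    \<comment> \<open>The tree and the arm length are scaled to \<open>F\<close>, the number of rows
      to \<open>k\<close>: a clique minor of order \<open>Suc k\<close> certifies treewidth
      \<open>k\<close>.\<close>
    let ?R = "pendant ?m (Suc k) ?m"
    let ?l = "card (verts F0)"
    let ?G = "\<lambda>l. pendant_clique {..<l::nat} ?R (Inl [])"
    have m: "0 < ?m" using two le by simp
    have host: "\<exists>G' :: nat sgraph. sgraph G' \<and> connected G' \<and> k \<le> treewidth G' \<and>
        contains G' (?G l) \<and> contains (?G l) G' \<and> (models G' \<phi> \<longleftrightarrow> models (?G l) \<phi>)" if l: "0 < l" for l
    proof -
      have sgG: "sgraph (?G l)" by (intro sgraph_pendant_clique sgraph_pendant) simp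
      have coG: "connected (?G l)"
        by (rule connected_pendant_clique[where c = 0, OF sgraph_pendant connected_pendant])
          (use m l in \<open>auto simp: short_lists_def\<close>)
      obtain G' :: "nat sgraph" where G': "sgraph G'" "connected G'" "contains G' (?G l)" "contains (?G l) G'"
        "\<And>\<phi>. sentence \<phi> \<Longrightarrow> models G' \<phi> \<longleftrightarrow> models (?G l) \<phi>"
        by (rule nat_copy[OF sgG coG]) (rule that)
      have "contains G' (web (Suc k) ?m)"
        using G'(3) pendant_clique_contains_web[of 0 "{..<l}"] l contains_trans by blast
      then have "k \<le> treewidth G'" using G'(1) m by (intro treewidth_ge_web)
      with G' phi(1) show ?thesis by blast
    qed
    obtain G1 :: "nat sgraph" where G1: "sgraph G1" "connected G1" "k \<le> treewidth G1"
      "contains G1 (?G ?l)" "models G1 \<phi> \<longleftrightarrow> models (?G ?l) \<phi>"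
      using host[of ?l] two by auto
    obtain G2 :: "nat sgraph" where G2: "sgraph G2" "connected G2" "k \<le> treewidth G2"
      "contains (?G (?l - 1)) G2" "models G2 \<phi> \<longleftrightarrow> models (?G (?l - 1)) \<phi>"
      using host[of "?l - 1"] two by auto
    have "contains G1 F"
      using contains_trans[OF G1(4) pendant_clique_contains[OF peel sg order_refl False]] .
    moreover have "\<not> contains (?G (?l - 1)) F0"
    proof (rule pendant_clique_not_contains[OF sgraph_pendant])
      show "S \<subseteq> {Inl []}" if "S \<subseteq> verts ?R" "card S \<le> ?l"
        "\<And>x. x \<in> S \<Longrightarrow> x \<noteq> Inl [] \<Longrightarrow> 2 \<le> card {y \<in> S. adj ?R x y}" for S
        using that(1) order_trans[OF that(2) le] that(3) by (rule pendant_no_small_dense_set[OF m])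
    qed (use two sg0 deg in auto)
    then have "\<not> contains G2 F"
      using contains_trans[OF G2(4)] contains_trans[OF _ contains_peel[OF peel]] by blast
    moreover have "models (?G ?l) \<phi> \<longleftrightarrow> models (?G (?l - 1)) \<phi>"
      by (rule models_pendant_clique[OF sgraph_pendant phi(1)]) (use phi(2) in auto)
    \<comment> \<open>The two hosts agree on \<phi> but not on containing \<open>F\<close>, so
      \<phi> errs on one of them.\<close>
    ultimately show "\<exists>G :: nat sgraph. sgraph G \<and> connected G \<and> k \<le> treewidth G \<and>
        \<not> (models G \<phi> \<longleftrightarrow> contains G F)"
      using G1(1,2,3,5) G2(1,2,3,5) by blast
  qed
qed simp

lemma complete_contains:
  assumes "sgraph F" "card (verts F) \<le> n"
  shows "contains (rel_graph {..<n} (\<lambda>_ _. True)) F"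
proof -
  have "finite (verts F)" using assms(1) by (simp add: sgraph_def)
  then obtain h where h: "bij_betw h (verts F) {..<card (verts F)}"
    using finite_same_card_bij[of "verts F" "{..<card (verts F)}"] by auto
  have lt: "h u < n" if "u \<in> verts F" for u
  proof -
    have "h u \<in> {..<card (verts F)}" using bij_betwE[OF h] that by blast
    then show ?thesis using assms(2) by simp
  qed
  have "h u \<noteq> h v" if "u \<in> verts F" "v \<in> verts F" "adj F u v" for u v
    using h that adjD(3)[OF assms(1)] by (auto simp: bij_betw_def inj_on_eq_iff)
  then show ?thesis
    using h lt by (intro containsI[of h]) (auto simp: bij_betw_def adj_rel_graph)
qed

lemma connected_complete: "0 < n \<Longrightarrow> connected (rel_graph {..<n :: nat} (\<lambda>_ _. True))"
  by (auto simp: connected_def connected_set_def adj_rel_graph intro: r_into_rtranclp)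

theorem W_tw_ge_2:
  fixes F :: "'a sgraph"
  assumes sg: "sgraph F" and co: "connected F" and mega: "\<not> (\<exists>b. contains (megastar 3 b) F)"
  shows "2 \<le> W_tw F"
proof (rule W_tw_geI[OF sg])
  fix \<phi> :: fo and k :: nat assume phi: "sentence \<phi>" "var_width \<phi> < 2"
  let ?m = "card (verts F)"
  let ?W = "web (Suc k) ?m"
  have m: "0 < ?m" using co sg by (simp add: connected_def sgraph_def card_gt_0_iff)
  obtain G1 :: "nat sgraph" where G1: "sgraph G1" "connected G1" "contains G1 ?W" "contains ?W G1"
    by (rule nat_copy[OF sgraph_web connected_web[OF zero_less_Suc m]]) (rule that)
  have "\<not> contains G1 F"
    using contains_trans[OF G1(4)] web_contains_imp_megastar[OF co order_refl m] mega by blast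
  moreover have tw1: "k \<le> treewidth G1" using G1(1,3) m by (rule treewidth_ge_web)
  \<comment> \<open>Large enough for \<open>F\<close> and also for the web, which certifies the
    treewidth of the complete graph.\<close>
  let ?n = "?m + card (web_verts (Suc k) ?m)"
  define K where "K = rel_graph {..<?n} (\<lambda>_ _. True)"
  have sgK: "sgraph K" unfolding K_def by (intro sgraph_rel_graph) simp
  have coK: "connected K" unfolding K_def using m by (intro connected_complete) simp
  have "contains K F" unfolding K_def using sg by (intro complete_contains) simp_all
  moreover have "contains K ?W" unfolding K_def by (intro complete_contains sgraph_web) simp
  then have "k \<le> treewidth K" using sgK m by (intro treewidth_ge_web)
  moreover have "models G1 \<phi> \<longleftrightarrow> models K \<phi>"
    using G1(1,2) sgK coK phi by (intro models_one_variable) (auto simp: connected_def)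
  ultimately show "\<exists>G :: nat sgraph. sgraph G \<and> connected G \<and> k \<le> treewidth G \<and>
      \<not> (models G \<phi> \<longleftrightarrow> contains G F)"
    using G1(1,2) tw1 sgK coK by blast
qed

text \<open>For connected \<open>F\<close>, containment in some \<open>megastar 3 b\<close> amounts
  to being a subtree of it, which is how the exception is expressed.\<close>

theorem theorem7:
  shows "(\<forall>F :: 'a sgraph. \<forall>F0. sgraph F \<and> is_core F F0 \<longrightarrow> W_tw F \<ge> card (verts F0)) \<and>
         (\<forall>F :: 'a sgraph. sgraph F \<and> connected F \<and> \<not> (\<exists>b. contains (megastar 3 b) F)
             \<longrightarrow> W_tw F \<ge> treewidth F + 1)"
proof (intro conjI allI impI)
  fix F F0 :: "'a sgraph" assume "sgraph F \<and> is_core F F0"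
  then show "W_tw F \<ge> card (verts F0)" by (blast intro: W_tw_ge_core)
next
  fix F :: "'a sgraph" assume F: "sgraph F \<and> connected F \<and> \<not> (\<exists>b. contains (megastar 3 b) F)"
  obtain F0 where F0: "is_core F F0" using core_exists F by blast
  have "treewidth F + 1 \<le> max 2 (card (verts F0))"
    using F0 F by (intro treewidth_le_core) (auto simp: is_core_def)
  also have "\<dots> \<le> W_tw F" using W_tw_ge_core[OF _ F0] W_tw_ge_2[of F] F by simp
  finally show "W_tw F \<ge> treewidth F + 1" .
qed

end
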